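(* Let $a_1,\dots,a_n$ be integers. Let $\mathcal{F}$ be a one-dimensional holomorphic foliation on the rational normal scroll $\mathbb{F}(a_1,\dots,a_n)$ and let $X$ be a quasi-homogeneous vector field which defines $\mathcal{F}$ in homogeneous coordinates. Let $V\subset\mathbb{F}(a_1,\dots,a_n)$ be a strongly quasi-smooth hypersurface invariant by $\mathcal{F}$. Then (i) if $n=1$, then $\deg(V)_2\leq\deg(\mathcal{F})_2+1$; (ii) if $n>1$, then $\deg(V)_2\leq\deg(\mathcal{F})_2+2$. Moreover, suppose that $a_1,\dots,a_n$ are non-positive integers. Then (i) if $a_1=a_2=\cdots=a_n=0$, then $\deg(V)_1\leq\deg(\mathcal{F})_1+2$; (ii) if $a_2=\cdots=a_n=0$ and $a_1$ is negative, then $\deg(V)_1\leq\deg(\mathcal{F})_1+1-a_1$; (iii) if at least two of the $a_i$ are negative, then $\deg(V)_1\leq\deg(\mathcal{F})_1-\min_{1\leq i<j \leq n}\{a_i+a_j\}$.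
   Context: $\mathbb{F}(a_1,\dots,a_n)=(\mathbb{C}^2\times\mathbb{C}^n\setminus\mathcal{Z})/(\mathbb{C}^* )^2$, where $\mathcal{Z}=(\{0\}\times\mathbb{C}^n)\cup(\mathbb{C}^2\times\{0\})$ and the action is $$(\lambda,\mu)(z_{1,1},z_{1,2},z_{2,1},\dots,z_{2,n})=(\lambda z_{1,1}, \lambda z_{1,2}, \mu\lambda^{-a_1} z_{2,1},\dots,\mu\lambda^{-a_n} z_{2,n}).$$ Its homogeneous coordinate ring is $\mathrm{S}=\mathbb{C}[z_{1,1},z_{1,2},z_{2,1},\dots,z_{2,n}]$, graded by $\mathbb{Z}^2$ with $\deg(z_{1,1})=\deg(z_{1,2})=(1,0)$ and $\deg(z_{2,i})=(-a_i,1)$; quasi-homogeneous means homogeneous for this bigrading. For $\alpha\in\mathbb{Z}^2$, $(\alpha)_k$ is its $k$-th coordinate. The radial vector fields are $R_1=z_{1,1}\frac{\partial}{\partial z_{1,1}}+z_{1,2}\frac{\partial}{\partial z_{1,2}}-\sum_{i=1}^n a_iz_{2,i}\frac{\partial}{\partial z_{2,i}}$ and $R_2=\sum_{i=1}^n z_{2,i}\frac{\partial}{\partial z_{2,i}}$. A one-dimensional holomorphic foliation $\mathcal{F}$ of bidegree $\deg(\mathcal{F})=(d_1,d_2)$ is a global section of $T\mathbb{F}(a_1,\dots,a_n)\otimes\mathcal{O}(d_1,d_2)$ whose singular set has codimension at least $2$. Only foliations are considered that are induced by a quasi-homogeneous vector field $X=\sum_w P_w\frac{\partial}{\partial w}$,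 the sum being over the $n+2$ coordinates $w$, with $P_w$ quasi-homogeneous of bidegree $\deg(\mathcal{F})+\deg(w)$; $X$ is determined modulo $g_1R_1+g_2R_2$ with $g_1,g_2\in\mathrm{S}$, and $\mathrm{Sing}(\mathcal{F})$ is the image of $\{R_1\wedge R_2\wedge X=0\}$ (in particular $X$ is not of the form $g_1R_1+g_2R_2$). For a nonconstant quasi-homogeneous $f$, the hypersurface $V=\{f=0\}$ has bidegree $\deg(V)=\deg(f)$; it is strongly quasi-smooth if $\{f=0\}$ is smooth on $\mathbb{C}^{n+2}\setminus\{0\}$, i.e. $f$ and all its partial derivatives have no common zero there. $V$ is invariant by $\mathcal{F}$ if $X(f)=g\cdot f$ for some quasi-homogeneous polynomial $g$. *)

theory Defs
  imports
    "HOL-Analysis.Analysis"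
    "HOL-Library.Poly_Mapping"
    "HOL-Library.Product_Plus"
    "HOL-Library.Extended_Nat"
begin

section \<open>Polynomials in countably many variables\<close>

text \<open>
  Exponent vectors are finitely supported functions on the variable indices, and polynomials are
  finitely supported functions on exponent vectors; the ring structure is that of
  \<^theory>\<open>HOL-Library.Poly_Mapping\<close>.
\<close>

type_synonym cpoly = "(nat \<Rightarrow>\<^sub>0 nat) \<Rightarrow>\<^sub>0 complex"

definition const_poly :: "complex \<Rightarrow> cpoly" where
  "const_poly c = Poly_Mapping.single 0 c"

definition var_poly :: "nat \<Rightarrow> cpoly" where
  "var_poly w = Poly_Mapping.single (Poly_Mapping.single w 1) 1"

definition eval_poly :: "cpoly \<Rightarrow> (nat \<Rightarrow> complex) \<Rightarrow> complex" where
  "eval_poly p z =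
     (\<Sum>m\<in>Poly_Mapping.keys p.
        Poly_Mapping.lookup p m * (\<Prod>w\<in>Poly_Mapping.keys m. z w ^ Poly_Mapping.lookup m w))"

text \<open>
  If the variable does not occur in a monomial, the truncated subtraction of exponents is harmless,
  because the coefficient below is then 0.
\<close>

definition partial_poly :: "nat \<Rightarrow> cpoly \<Rightarrow> cpoly" where
  "partial_poly w p =
     (\<Sum>m\<in>Poly_Mapping.keys p.
        Poly_Mapping.single (m - Poly_Mapping.single w 1)
          (of_nat (Poly_Mapping.lookup m w) * Poly_Mapping.lookup p m))"


section \<open>Irreducible closed sets and codimension in a topological space\<close>

definition irreducible_closedin :: "'a topology \<Rightarrow> 'a set \<Rightarrow> bool" where
  "irreducible_closedin T Y \<longleftrightarrow>
     closedin T Y \<and> Y \<noteq> {} \<and>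
     (\<forall>A B. closedin T A \<and> closedin T B \<and> Y = A \<union> B \<longrightarrow> Y = A \<or> Y = B)"

definition codim_irreducible :: "'a topology \<Rightarrow> 'a set \<Rightarrow> enat" where
  "codim_irreducible T Y =
     Sup {enat k | k. \<exists>C. C 0 = Y \<and> (\<forall>i\<le>k. irreducible_closedin T (C i)) \<and>
                          (\<forall>i<k. C i \<subset> C (Suc i))}"

text \<open>The empty set has codimension \<open>\<infinity>\<close>.\<close>

definition codim_closed :: "'a topology \<Rightarrow> 'a set \<Rightarrow> enat" where
  "codim_closed T S = Inf (codim_irreducible T ` {Y. irreducible_closedin T Y \<and> Y \<subseteq> S})"


section \<open>Rational normal scrolls\<close>

text \<open>
  The coordinates are numbered \<open>0, \<dots>, n + 1\<close>: \<open>z\<^bsub>1,1\<^esub>\<close> and \<open>z\<^bsub>1,2\<^esub>\<close> have index \<open>0\<close> and \<open>1\<close>,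
  and \<open>z\<^bsub>2,i\<^esub>\<close> has index \<open>i + 1\<close> for \<open>1 \<le> i \<le> n\<close>. A point of \<open>\<complex>\<^bsup>n+2\<^esup>\<close> is a function vanishing
  at all larger indices. Only the values \<open>a 1, \<dots>, a n\<close> matter.
\<close>

definition coord_space :: "nat \<Rightarrow> (nat \<Rightarrow> complex) set" where
  "coord_space n = {z. \<forall>w\<ge>n + 2. z w = 0}"

definition exceptional_set :: "nat \<Rightarrow> (nat \<Rightarrow> complex) set" where
  "exceptional_set n =
     {z \<in> coord_space n. z 0 = 0 \<and> z 1 = 0} \<union>
     {z \<in> coord_space n. \<forall>i\<in>{1..n}. z (i + 1) = 0}"

definition scroll_cover :: "nat \<Rightarrow> (nat \<Rightarrow> complex) set" where
  "scroll_cover n = coord_space n - exceptional_set n"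

definition torus_act ::
  "(nat \<Rightarrow> int) \<Rightarrow> complex \<Rightarrow> complex \<Rightarrow> (nat \<Rightarrow> complex) \<Rightarrow> (nat \<Rightarrow> complex)" where
  "torus_act a l m z =
     (\<lambda>w. if w < 2 then l * z w else m * l powi (- a (w - 1)) * z w)"

definition torus_orbit :: "(nat \<Rightarrow> int) \<Rightarrow> (nat \<Rightarrow> complex) \<Rightarrow> (nat \<Rightarrow> complex) set" where
  "torus_orbit a z = {torus_act a l m z | l m. l \<noteq> 0 \<and> m \<noteq> 0}"

definition scroll :: "nat \<Rightarrow> (nat \<Rightarrow> int) \<Rightarrow> (nat \<Rightarrow> complex) set set" where
  "scroll n a = torus_orbit a ` scroll_cover n"

definition coord_ring :: "nat \<Rightarrow> cpoly set" where
  "coord_ring n = {p. \<forall>m\<in>Poly_Mapping.keys p. Poly_Mapping.keys m \<subseteq> {..<n + 2}}"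

definition coord_zariski :: "nat \<Rightarrow> (nat \<Rightarrow> complex) topology" where
  "coord_zariski n =
     topology_generated_by {{z \<in> coord_space n. eval_poly p z \<noteq> 0} | p. p \<in> coord_ring n}"

text \<open>
  The scroll is a geometric quotient of its cover by the torus, so its Zariski topology is the
  quotient topology.
\<close>

definition scroll_zariski :: "nat \<Rightarrow> (nat \<Rightarrow> int) \<Rightarrow> (nat \<Rightarrow> complex) set topology" where
  "scroll_zariski n a =
     topology (\<lambda>T. T \<subseteq> scroll n a \<and>
       openin (subtopology (coord_zariski n) (scroll_cover n))
         {z \<in> scroll_cover n. torus_orbit a z \<in> T})"

lemma openin_scroll_zariski:
  "openin (scroll_zariski n a) T \<longleftrightarrow>
     T \<subseteq> scroll n a \<and>
     openin (subtopology (coord_zariski n) (scroll_cover n))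
       {z \<in> scroll_cover n. torus_orbit a z \<in> T}"
proof -
  let ?O = "openin (subtopology (coord_zariski n) (scroll_cover n))"
  let ?pre = "\<lambda>T. {z \<in> scroll_cover n. torus_orbit a z \<in> T}"
  have "istopology (\<lambda>T. T \<subseteq> scroll n a \<and> ?O (?pre T))"
    unfolding istopology_def
  proof (intro conjI allI impI)
    fix S T
    assume S: "S \<subseteq> scroll n a \<and> ?O (?pre S)" and T: "T \<subseteq> scroll n a \<and> ?O (?pre T)"
    have "?pre (S \<inter> T) = ?pre S \<inter> ?pre T" by auto
    with openin_Int[OF conjunct2[OF S] conjunct2[OF T]] show "?O (?pre (S \<inter> T))"
      by (simp only:)
    show "S \<inter> T \<subseteq> scroll n a" using S by auto
  next
    fix \<K>
    assume K: "\<forall>K\<in>\<K>. K \<subseteq> scroll n a \<and> ?O (?pre K)"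
    have "?pre (\<Union>\<K>) = \<Union>(?pre ` \<K>)" by blast
    moreover have "?O (\<Union>(?pre ` \<K>))" using K by (intro openin_Union) blast
    ultimately show "?O (?pre (\<Union>\<K>))" by (simp only:)
    show "\<Union>\<K> \<subseteq> scroll n a" using K by auto
  qed
  then show ?thesis
    unfolding scroll_zariski_def by (simp only: topology_inverse')
qed


section \<open>Bigrading\<close>

definition var_bideg :: "(nat \<Rightarrow> int) \<Rightarrow> nat \<Rightarrow> int \<times> int" where
  "var_bideg a w = (if w < 2 then (1, 0) else (- a (w - 1), 1))"

definition monom_bideg :: "(nat \<Rightarrow> int) \<Rightarrow> (nat \<Rightarrow>\<^sub>0 nat) \<Rightarrow> int \<times> int" where
  "monom_bideg a m =
     (\<Sum>w\<in>Poly_Mapping.keys m. int (Poly_Mapping.lookup m w) * fst (var_bideg a w),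
      \<Sum>w\<in>Poly_Mapping.keys m. int (Poly_Mapping.lookup m w) * snd (var_bideg a w))"

text \<open>The zero polynomial is quasi-homogeneous of every bidegree.\<close>

definition quasi_homogeneous :: "nat \<Rightarrow> (nat \<Rightarrow> int) \<Rightarrow> int \<times> int \<Rightarrow> cpoly \<Rightarrow> bool" where
  "quasi_homogeneous n a e p \<longleftrightarrow>
     p \<in> coord_ring n \<and> (\<forall>m\<in>Poly_Mapping.keys p. monom_bideg a m = e)"


section \<open>Vector fields and foliations\<close>

text \<open>
  A polynomial vector field \<open>\<Sum>\<^sub>w P\<^sub>w \<partial>/\<partial>w\<close> on \<open>\<complex>\<^bsup>n+2\<^esup>\<close> is the function \<open>w \<mapsto> P\<^sub>w\<close>, extended by 0.
\<close>

definition qh_vector_field :: "nat \<Rightarrow> (nat \<Rightarrow> int) \<Rightarrow> int \<times> int \<Rightarrow> (nat \<Rightarrow> cpoly) \<Rightarrow> bool" where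
  "qh_vector_field n a d X \<longleftrightarrow>
     (\<forall>w<n + 2. quasi_homogeneous n a (d + var_bideg a w) (X w)) \<and> (\<forall>w\<ge>n + 2. X w = 0)"

definition radial1 :: "nat \<Rightarrow> (nat \<Rightarrow> int) \<Rightarrow> nat \<Rightarrow> cpoly" where
  "radial1 n a w =
     (if w < 2 then var_poly w
      else if w < n + 2 then - (of_int (a (w - 1)) * var_poly w) else 0)"

definition radial2 :: "nat \<Rightarrow> nat \<Rightarrow> cpoly" where
  "radial2 n w = (if 2 \<le> w \<and> w < n + 2 then var_poly w else 0)"

definition apply_field :: "nat \<Rightarrow> (nat \<Rightarrow> cpoly) \<Rightarrow> cpoly \<Rightarrow> cpoly" where
  "apply_field n X f = (\<Sum>w<n + 2. X w * partial_poly w f)"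

text \<open>The coefficient of \<open>\<partial>\<^sub>u \<and> \<partial>\<^sub>v \<and> \<partial>\<^sub>w\<close> in \<open>A \<and> B \<and> C\<close>.\<close>

definition wedge3_coeff ::
  "(nat \<Rightarrow> 'a::comm_ring) \<Rightarrow> (nat \<Rightarrow> 'a) \<Rightarrow> (nat \<Rightarrow> 'a) \<Rightarrow> nat \<Rightarrow> nat \<Rightarrow> nat \<Rightarrow> 'a" where
  "wedge3_coeff A B C u v w =
     A u * (B v * C w - B w * C v) - A v * (B u * C w - B w * C u) + A w * (B u * C v - B v * C u)"

text \<open>
  Sections of \<open>T\<bbbF>(a\<^sub>1,\<dots>,a\<^sub>n) \<otimes> \<O>(d\<^sub>1,d\<^sub>2)\<close> coming from homogeneous coordinates are represented by
  the classes of quasi-homogeneous vector fields modulo the radial ones; the elements of a class are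
  the vector fields that define the section. The value of \<open>R\<^sub>1 \<and> R\<^sub>2 \<and> X\<close> depends only on the class
  of \<open>X\<close>.
\<close>

definition field_class ::
  "nat \<Rightarrow> (nat \<Rightarrow> int) \<Rightarrow> int \<times> int \<Rightarrow> (nat \<Rightarrow> cpoly) \<Rightarrow> (nat \<Rightarrow> cpoly) set" where
  "field_class n a d X =
     {Y. qh_vector_field n a d Y \<and>
         (\<exists>g1\<in>coord_ring n. \<exists>g2\<in>coord_ring n.
            \<forall>w. Y w = X w + g1 * radial1 n a w + g2 * radial2 n w)}"

definition sing_set ::
  "nat \<Rightarrow> (nat \<Rightarrow> int) \<Rightarrow> (nat \<Rightarrow> cpoly) set \<Rightarrow> (nat \<Rightarrow> complex) set set" where
  "sing_set n a F =
     torus_orbit a ` {z \<in> scroll_cover n. \<forall>X\<in>F. \<forall>u<n + 2. \<forall>v<n + 2. \<forall>w<n + 2.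
        wedge3_coeff (\<lambda>i. eval_poly (radial1 n a i) z) (\<lambda>i. eval_poly (radial2 n i) z)
          (\<lambda>i. eval_poly (X i) z) u v w = 0}"

definition foliation ::
  "nat \<Rightarrow> (nat \<Rightarrow> int) \<Rightarrow> int \<times> int \<Rightarrow> (nat \<Rightarrow> cpoly) set \<Rightarrow> bool" where
  "foliation n a d F \<longleftrightarrow>
     (\<exists>X. qh_vector_field n a d X \<and> F = field_class n a d X) \<and>
     2 \<le> codim_closed (scroll_zariski n a) (sing_set n a F)"


section \<open>Hypersurfaces\<close>

text \<open>A hypersurface of bidegree \<open>e\<close> is given by its equation \<open>f\<close>.\<close>

definition hypersurface_eq :: "nat \<Rightarrow> (nat \<Rightarrow> int) \<Rightarrow> int \<times> int \<Rightarrow> cpoly \<Rightarrow> bool" where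
  "hypersurface_eq n a e f \<longleftrightarrow> quasi_homogeneous n a e f \<and> (\<nexists>c. f = const_poly c)"

definition strongly_quasi_smooth :: "nat \<Rightarrow> cpoly \<Rightarrow> bool" where
  "strongly_quasi_smooth n f \<longleftrightarrow>
     \<not> (\<exists>z \<in> coord_space n - {\<lambda>_. 0}.
          eval_poly f z = 0 \<and> (\<forall>w<n + 2. eval_poly (partial_poly w f) z = 0))"

definition invariant_hypersurface ::
  "nat \<Rightarrow> (nat \<Rightarrow> int) \<Rightarrow> (nat \<Rightarrow> cpoly) \<Rightarrow> cpoly \<Rightarrow> bool" where
  "invariant_hypersurface n a X f \<longleftrightarrow>
     (\<exists>g c. quasi_homogeneous n a c g \<and> apply_field n X f = g * f)"

end

theory Submission
  imports Defs "HOL-Computational_Algebra.Fundamental_Theorem_Algebra"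
begin

text \<open>
  The idea is that an invariant hypersurface \<open>f = 0\<close> comes with a syzygy of the partial derivatives of
  \<open>f\<close>, and that strong quasi-smoothness leaves only Koszul syzygies, whose degrees are bounded below.

  The equation \<open>f\<close> is not constant, so its bidegree \<open>e\<close> is not \<open>(0, 0)\<close>, and some radial field \<open>R\<close>
  satisfies \<open>R f = r f\<close> with a number \<open>r \<noteq> 0\<close>. If \<open>X f = g f\<close>, then \<open>Y = X - (g / r) R\<close> annihilates \<open>f\<close>. It
  is not zero, because otherwise the foliation would be singular along the whole scroll, which is
  irreducible (\<open>annihilating_field_of_invariant_hypersurface\<close>, \<open>foliation_not_radial\<close>).

  By Euler's relation the partial derivatives of \<open>f\<close> have no common zero outside the origin. Hence their
  ideal contains a power of each of the \<open>n + 2\<close> coordinates (\<open>partials_generate_variable_power\<close>). There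
  are as many partial derivatives as there are terms in the regular sequence formed by these powers, so
  their Koszul complex is exact. In particular, for a syzygy \<open>\<Sum> Y\<^sub>j \<partial>f/\<partial>z\<^sub>j = 0\<close>, each entry \<open>Y\<^sub>i\<close> lies in
  the ideal of the partial derivatives with \<open>j \<noteq> i\<close> (\<open>syzygy_entry_in_ideal_of_others\<close>). For a nonzero
  \<open>Y\<^sub>i\<close>, comparison of bidegrees gives \<open>d + deg z\<^sub>i + deg z\<^sub>j = e + deg m\<close> with some \<open>j \<noteq> i\<close> and some
  monomial \<open>m\<close>. The bounds are the maxima of the components of \<open>deg z\<^sub>i + deg z\<^sub>j\<close>.

  The Nullstellensatz is proved for polynomials in countably many variables over the complex numbers by
  comparing cardinalities: a field extension of countable dimension is algebraic, as \<open>1 / (t - c)\<close> for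
  uncountably many \<open>c\<close> are independent when \<open>t\<close> is transcendental.
\<close>

section \<open>Syzygies and regular sequences in commutative rings\<close>

text \<open>
  A ring is a module over itself, and its submodules are its ideals. This gives spans as generated
  ideals. Since scaling is multiplication here, the rule \<open>scale_scale\<close> rewrites against associativity
  and would make the simplifier loop.
\<close>

interpretation ideal: module "(*) :: 'a::comm_ring_1 \<Rightarrow> 'a \<Rightarrow> 'a"
  by unfold_locales (simp_all add: algebra_simps)

declare ideal.scale_scale [simp del]

definition koszul_sign :: "nat \<Rightarrow> nat set \<Rightarrow> 'a::comm_ring_1" where
  "koszul_sign j S = (- 1) ^ card {i \<in> S. i < j}"

text \<open>
  A Koszul chain assigns to each \<open>S \<subseteq> {..<N}\<close> the coefficient of the wedge of the \<open>e\<^sub>i\<close>, \<open>i \<in> S\<close>, in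
  increasing order. The differential is contraction with \<open>f\<close>, and \<open>koszul_wedge g\<close> below is the
  exterior product with \<open>\<Sum> g\<^sub>i e\<^sub>i\<close>.
\<close>

definition koszul_diff ::
  "nat \<Rightarrow> (nat \<Rightarrow> 'a::comm_ring_1) \<Rightarrow> (nat set \<Rightarrow> 'a) \<Rightarrow> nat set \<Rightarrow> 'a" where
  "koszul_diff N f c S = (\<Sum>j\<in>{..<N} - S. koszul_sign j S * f j * c (insert j S))"

definition koszul_wedge ::
  "(nat \<Rightarrow> 'a::comm_ring_1) \<Rightarrow> (nat set \<Rightarrow> 'a) \<Rightarrow> nat set \<Rightarrow> 'a" where
  "koszul_wedge g c S = (\<Sum>i\<in>S. koszul_sign i S * g i * c (S - {i}))"

lemma koszul_sign_square: "koszul_sign j S * koszul_sign j S = (1::'a::comm_ring_1)"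
  by (simp add: koszul_sign_def flip: power_add mult_2 power_mult)

lemma koszul_sign_insert:
  assumes "finite S" "i \<notin> S"
  shows "koszul_sign j (insert i S) =
    (if i < j then - koszul_sign j S else (koszul_sign j S :: 'a::comm_ring_1))"
proof -
  have "{k \<in> insert i S. k < j} =
      (if i < j then insert i {k \<in> S. k < j} else {k \<in> S. k < j})" by auto
  then show ?thesis using assms by (simp add: koszul_sign_def)
qed

text \<open>
  Of two different indices, inserting the smaller one first flips the sign of the larger one, whereas
  the larger one never affects the sign of the smaller one.
\<close>

lemma koszul_sign_swap:
  assumes "finite S" "i \<notin> S" "j \<notin> S" "i \<noteq> j"
  shows "koszul_sign i S * koszul_sign j (insert i S) =
    - (koszul_sign j S * koszul_sign i (insert j S) :: 'a::comm_ring_1)"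
  using assms by (cases "i < j") (auto simp: koszul_sign_insert mult.commute)

lemma koszul_sign_swap':
  assumes "finite S" "i \<in> S" "j \<notin> S"
  shows "koszul_sign j S * koszul_sign i (insert j S) =
    - (koszul_sign i S * koszul_sign j (S - {i}) :: 'a::comm_ring_1)"
proof -
  define T where "T = S - {i}"
  have T: "finite T" "i \<notin> T" "j \<notin> T" "i \<noteq> j" "S = insert i T" using assms by (auto simp: T_def)
  have ins: "koszul_sign i (insert i U) = (koszul_sign i U :: 'a)" for U
    by (simp add: koszul_sign_def cong: conj_cong) (metis less_irrefl)
  have "insert j (insert i T) = insert i (insert j T)" by auto
  then show ?thesis unfolding T_def[symmetric] \<open>S = insert i T\<close>
    using koszul_sign_swap[of T i j, where 'a = 'a] T
    by (cases "i < j") (simp_all add: koszul_sign_insert ins mult.commute)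
qed

lemma sum_antisymmetric_eq_0:
  fixes h :: "'b \<Rightarrow> 'b \<Rightarrow> 'a::ab_group_add"
  assumes "finite A" "\<And>i j. i \<in> A \<Longrightarrow> j \<in> A \<Longrightarrow> i \<noteq> j \<Longrightarrow> h i j = - h j i"
  shows "(\<Sum>i\<in>A. \<Sum>j\<in>A - {i}. h i j) = 0"
  using assms
proof (induction A rule: finite_induct)
  case (insert a A)
  have "(\<Sum>i\<in>insert a A. \<Sum>j\<in>insert a A - {i}. h i j)
      = (\<Sum>j\<in>A. h a j) + (\<Sum>i\<in>A. \<Sum>j\<in>insert a (A - {i}). h i j)"
  proof -
    have "insert a A - {i} = insert a (A - {i})" if "i \<in> A" for i
      using that insert.hyps by auto
    then show ?thesis using insert.hyps by simp
  qed
  also have "(\<Sum>i\<in>A. \<Sum>j\<in>insert a (A - {i}). h i j)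
      = (\<Sum>i\<in>A. h i a) + (\<Sum>i\<in>A. \<Sum>j\<in>A - {i}. h i j)"
    using insert.hyps by (simp add: sum.distrib)
  also have "(\<Sum>i\<in>A. \<Sum>j\<in>A - {i}. h i j) = 0"
    by (intro insert.IH insert.prems) auto
  also have "(\<Sum>i\<in>A. h i a) = - (\<Sum>i\<in>A. h a i)"
    unfolding sum_negf[symmetric]
    using insert.hyps(2) by (intro sum.cong refl insert.prems) auto
  finally show ?case by simp
qed simp

lemma koszul_diff_diff:
  assumes "S \<subseteq> {..<N}"
  shows "koszul_diff N f (koszul_diff N f c) S = 0"
proof -
  have fin: "finite S" using assms finite_subset by blast
  have "koszul_diff N f (koszul_diff N f c) S =
     (\<Sum>j\<in>{..<N} - S. \<Sum>i\<in>({..<N} - S) - {j}.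
        koszul_sign j S * koszul_sign i (insert j S) * f i * f j * c (insert i (insert j S)))"
    unfolding koszul_diff_def sum_distrib_left Diff_insert[symmetric]
    by (intro sum.cong refl) (simp only: mult_ac)
  also have "\<dots> = 0"
  proof (rule sum_antisymmetric_eq_0)
    fix i j assume ij: "i \<in> {..<N} - S" "j \<in> {..<N} - S" "i \<noteq> j"
    have swap: "koszul_sign i S * koszul_sign j (insert i S) =
        - (koszul_sign j S * koszul_sign i (insert j S) :: 'a)"
      using koszul_sign_swap[OF fin, of i j] ij by simp
    show "koszul_sign i S * koszul_sign j (insert i S) * f j * f i * c (insert j (insert i S)) =
       - (koszul_sign j S * koszul_sign i (insert j S) * f i * f j * c (insert i (insert j S)))"
      unfolding swap insert_commute[of j i] mult.assoc mult.left_commute[of "f j" "f i"]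
      by (simp only: mult_minus_left mult_minus_right mult.assoc)
  qed simp
  finally show ?thesis .
qed

text \<open>
  Contraction is a graded derivation of the exterior algebra, so contracting \<open>g \<and> c\<close> gives
  \<open>\<langle>f, g\<rangle> c - g \<and> \<langle>f, c\<rangle>\<close>: multiplication by an element of the ideal of the \<open>f j\<close> is null-homotopic.
  In coordinates, the terms that remove one index and insert a different one cancel by the sign
  rule for exchanging the two steps.
\<close>

lemma koszul_homotopy:
  assumes "S \<subseteq> {..<N}"
  shows "koszul_diff N f (koszul_wedge g c) S + koszul_wedge g (koszul_diff N f c) S =
         (\<Sum>j<N. g j * f j) * c S"
proof -
  have fin: "finite S" using assms finite_subset by blast
  have sgn_self: "koszul_sign j S * koszul_sign j (insert j S) = (1::'a)" for j
  proof -
    have "koszul_sign j (insert j S) = (koszul_sign j S :: 'a)"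
      unfolding koszul_sign_def by (rule arg_cong[where f = "\<lambda>T. (- 1) ^ card T"]) auto
    then show ?thesis by (simp add: koszul_sign_square)
  qed
  have sgn_self': "koszul_sign j S * koszul_sign j (S - {j}) = (1::'a)" for j
  proof -
    have "koszul_sign j (S - {j}) = (koszul_sign j S :: 'a)"
      unfolding koszul_sign_def by (rule arg_cong[where f = "\<lambda>T. (- 1) ^ card T"]) auto
    then show ?thesis by (simp add: koszul_sign_square)
  qed
  let ?t = "\<lambda>i j. koszul_sign j S * koszul_sign i (insert j S) * g i * f j * c (insert j S - {i})"
  have "koszul_diff N f (koszul_wedge g c) S =
      (\<Sum>j\<in>{..<N} - S. koszul_sign j S * f j * (koszul_sign j (insert j S) * g j * c S
         + (\<Sum>i\<in>S. koszul_sign i (insert j S) * g i * c (insert j S - {i}))))"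
    unfolding koszul_diff_def koszul_wedge_def using fin by (intro sum.cong refl) simp
  also have "\<dots> = (\<Sum>j\<in>{..<N} - S. (koszul_sign j S * koszul_sign j (insert j S)) * (g j * f j * c S)
         + (\<Sum>i\<in>S. ?t i j))"
    by (intro sum.cong refl) (simp only: distrib_left sum_distrib_left mult_ac)
  also have "\<dots> = (\<Sum>j\<in>{..<N} - S. g j * f j * c S) + (\<Sum>j\<in>{..<N} - S. \<Sum>i\<in>S. ?t i j)"
    by (simp add: sgn_self sum.distrib)
  finally have dh: "koszul_diff N f (koszul_wedge g c) S =
    (\<Sum>j\<in>{..<N} - S. g j * f j * c S) + (\<Sum>j\<in>{..<N} - S. \<Sum>i\<in>S. ?t i j)" .
  have "koszul_wedge g (koszul_diff N f c) S =
      (\<Sum>i\<in>S. koszul_sign i S * g i * (koszul_sign i (S - {i}) * f i * c S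
         + (\<Sum>j\<in>{..<N} - S. koszul_sign j (S - {i}) * f j * c (insert j (S - {i})))))"
    unfolding koszul_diff_def koszul_wedge_def
  proof (intro sum.cong refl)
    fix i assume i: "i \<in> S"
    have "{..<N} - (S - {i}) = insert i ({..<N} - S)" "insert i S = S" using i assms by auto
    then show "koszul_sign i S * g i *
        (\<Sum>j\<in>{..<N} - (S - {i}). koszul_sign j (S - {i}) * f j * c (insert j (S - {i}))) =
        koszul_sign i S * g i * (koszul_sign i (S - {i}) * f i * c S
         + (\<Sum>j\<in>{..<N} - S. koszul_sign j (S - {i}) * f j * c (insert j (S - {i}))))"
      using i by simp
  qed
  also have "\<dots> = (\<Sum>i\<in>S. (koszul_sign i S * koszul_sign i (S - {i})) * (g i * f i * c S)
         + (\<Sum>j\<in>{..<N} - S. - ?t i j))"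
  proof (intro sum.cong refl)
    fix i assume i: "i \<in> S"
    have "koszul_sign i S * g i * (koszul_sign j (S - {i}) * f j * c (insert j (S - {i}))) = - ?t i j"
      if "j \<in> {..<N} - S" for j
    proof -
      have set_eq: "insert j (S - {i}) = insert j S - {i}" using that i by auto
      have "koszul_sign i S * g i * (koszul_sign j (S - {i}) * f j * c (insert j (S - {i}))) =
          (koszul_sign i S * koszul_sign j (S - {i})) * (g i * f j * c (insert j S - {i}))"
        unfolding set_eq by (simp only: mult_ac)
      also have "koszul_sign i S * koszul_sign j (S - {i}) =
          - (koszul_sign j S * koszul_sign i (insert j S) :: 'a)"
        using koszul_sign_swap'[OF fin i, of j, where 'a = 'a] that by simp
      finally show ?thesis by (simp only: mult.assoc mult_minus_left)
    qed
    then show "koszul_sign i S * g i * (koszul_sign i (S - {i}) * f i * c S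
         + (\<Sum>j\<in>{..<N} - S. koszul_sign j (S - {i}) * f j * c (insert j (S - {i})))) =
        (koszul_sign i S * koszul_sign i (S - {i})) * (g i * f i * c S)
         + (\<Sum>j\<in>{..<N} - S. - ?t i j)"
      by (simp only: distrib_left sum_distrib_left mult_ac cong: sum.cong)
  qed
  also have "\<dots> = (\<Sum>i\<in>S. g i * f i * c S) - (\<Sum>i\<in>S. \<Sum>j\<in>{..<N} - S. ?t i j)"
    by (simp add: sgn_self' sum.distrib sum_negf sum_subtractf)
  also have "(\<Sum>i\<in>S. \<Sum>j\<in>{..<N} - S. ?t i j) = (\<Sum>j\<in>{..<N} - S. \<Sum>i\<in>S. ?t i j)"
    by (rule sum.swap)
  finally have hd: "koszul_wedge g (koszul_diff N f c) S =
    (\<Sum>i\<in>S. g i * f i * c S) - (\<Sum>j\<in>{..<N} - S. \<Sum>i\<in>S. ?t i j)" .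
  have "(\<Sum>j<N. g j * f j * c S) = (\<Sum>j\<in>{..<N} - S. g j * f j * c S) + (\<Sum>i\<in>S. g i * f i * c S)"
    by (rule sum.subset_diff[OF assms]) simp
  then show ?thesis using dh hd by (simp add: sum_distrib_right)
qed

definition regular_sequence :: "nat \<Rightarrow> (nat \<Rightarrow> 'a::comm_ring_1) \<Rightarrow> bool" where
  "regular_sequence N x \<longleftrightarrow>
     (\<forall>k<N. \<forall>q. x k * q \<in> ideal.span (x ` {..<k}) \<longrightarrow> q \<in> ideal.span (x ` {..<k}))"

lemma koszul_diff_add:
  "koszul_diff N f (\<lambda>T. b T + c T) S = koszul_diff N f b S + koszul_diff N f c S"
  by (simp add: koszul_diff_def distrib_left sum.distrib)

lemma koszul_diff_scale: "koszul_diff N f (\<lambda>T. q * c T) S = q * koszul_diff N f c S"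
  by (simp add: koszul_diff_def sum_distrib_left mult_ac)

lemma koszul_diff_cong:
  "S \<subseteq> {..<N} \<Longrightarrow> (\<And>T. T \<subseteq> {..<N} \<Longrightarrow> b T = c T) \<Longrightarrow> koszul_diff N f b S = koszul_diff N f c S"
  unfolding koszul_diff_def by (intro sum.cong) auto

lemma koszul_diff_in_ideal:
  assumes "ideal.subspace J" "S \<subseteq> {..<N}" "\<And>T. T \<subseteq> {..<N} \<Longrightarrow> c T \<in> J"
  shows "koszul_diff N f c S \<in> J"
  unfolding koszul_diff_def using assms
  by (intro ideal.subspace_sum[OF assms(1)] ideal.subspace_scale[OF assms(1)]) auto

lemma koszul_wedge_in_ideal:
  assumes "ideal.subspace J" "S \<subseteq> {..<N}" "\<And>T. T \<subseteq> {..<N} \<Longrightarrow> c T \<in> J"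
  shows "koszul_wedge g c S \<in> J"
  unfolding koszul_wedge_def using assms(2)
  by (intro ideal.subspace_sum[OF assms(1)] ideal.subspace_scale[OF assms(1)] assms(3)) auto

text \<open>
  This is depth sensitivity of the Koszul complex. Let \<open>J\<^sub>l\<close> be the ideal of \<open>x 0, \<dots>, x (l - 1)\<close>. Exactness
  in degree \<open>l + 1\<close> modulo \<open>J\<^sub>l\<close> is proved by descending induction on \<open>l\<close>. There are no chains of degree
  \<open>N + 1\<close>, which settles \<open>l = N\<close>. Given a cycle \<open>c\<close> modulo \<open>J\<^sub>l\<close>, write \<open>x l = \<Sum> g j * f j\<close>. By the
  homotopy, \<open>g \<and> c\<close> is a cycle modulo \<open>J\<^bsub>l+1\<^esub>\<close>, hence of the form \<open>d b + x l * r\<close> modulo \<open>J\<^sub>l\<close>.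
  Differentiating once more, \<open>x l * c\<close> agrees with \<open>x l * d r\<close> modulo
  \<open>J\<^sub>l\<close>, and \<open>x l\<close> may be cancelled.
\<close>

lemma koszul_exact_mod_regular:
  fixes f x :: "nat \<Rightarrow> 'a::comm_ring_1"
  assumes reg: "regular_sequence N x"
    and x: "\<And>k. k < N \<Longrightarrow> \<exists>g. x k = (\<Sum>j<N. g j * f j)"
    and "l \<le> N"
    and deg: "\<And>S. S \<subseteq> {..<N} \<Longrightarrow> card S \<noteq> Suc l \<Longrightarrow> c S = 0"
    and cyc: "\<And>S. S \<subseteq> {..<N} \<Longrightarrow> koszul_diff N f c S \<in> ideal.span (x ` {..<l})"
  shows "\<exists>b. \<forall>S\<subseteq>{..<N}. c S - koszul_diff N f b S \<in> ideal.span (x ` {..<l})"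
  using \<open>l \<le> N\<close> deg cyc
proof (induction l arbitrary: c rule: inc_induct)
  case base
  have "c S = 0" if "S \<subseteq> {..<N}" for S
    using card_mono[OF _ that] by (intro base.prems that) auto
  then show ?case
    by (intro exI[of _ "\<lambda>_. 0"]) (simp add: koszul_diff_def ideal.span_zero)
next
  case (step l)
  let ?J = "ideal.span (x ` {..<l})" and ?J' = "ideal.span (x ` {..<Suc l})"
  have J': "p \<in> ?J' \<longleftrightarrow> (\<exists>q. p - q * x l \<in> ?J)" for p
    by (simp add: lessThan_Suc ideal.span_breakdown_eq)
  obtain g where g: "x l = (\<Sum>j<N. g j * f j)" using x step.hyps by blast
  define h where "h = koszul_wedge g c"
  have hom: "koszul_diff N f h S + koszul_wedge g (koszul_diff N f c) S = x l * c S"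
    if "S \<subseteq> {..<N}" for S
    unfolding h_def g using that by (rule koszul_homotopy)
  have wd: "koszul_wedge g (koszul_diff N f c) S \<in> ?J" if "S \<subseteq> {..<N}" for S
    using that step.prems(2) by (intro koszul_wedge_in_ideal) auto
  have "h S = 0" if "S \<subseteq> {..<N}" "card S \<noteq> Suc (Suc l)" for S
    unfolding h_def koszul_wedge_def
  proof (intro sum.neutral ballI)
    fix i assume i: "i \<in> S"
    have "finite S" using that finite_subset by blast
    then have "Suc (card (S - {i})) = card S" using i by (metis card.remove)
    then have "c (S - {i}) = 0" using that i by (intro step.prems) auto
    then show "koszul_sign i S * g i * c (S - {i}) = 0" by simp
  qed
  moreover have "koszul_diff N f h S \<in> ?J'" if "S \<subseteq> {..<N}" for S
  proof -
    have "koszul_diff N f h S - c S * x l = - koszul_wedge g (koszul_diff N f c) S"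
      using hom[OF that] by (simp add: algebra_simps add_eq_0_iff)
    then show ?thesis using wd[OF that] ideal.span_neg J' by metis
  qed
  ultimately obtain b where b: "\<And>S. S \<subseteq> {..<N} \<Longrightarrow> h S - koszul_diff N f b S \<in> ?J'"
    using step.IH[of h] by auto
  then obtain r where r: "\<And>S. S \<subseteq> {..<N} \<Longrightarrow> h S - koszul_diff N f b S - r S * x l \<in> ?J"
    unfolding J' by metis
  have "c S - koszul_diff N f r S \<in> ?J" if S: "S \<subseteq> {..<N}" for S
  proof -
    define y where "y T = h T - koszul_diff N f b T - r T * x l" for T
    have "koszul_diff N f h S =
        koszul_diff N f (\<lambda>T. y T + (koszul_diff N f b T + x l * r T)) S"
      by (rule koszul_diff_cong[OF S]) (simp add: y_def)
    also have "\<dots> = koszul_diff N f y S + x l * koszul_diff N f r S"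
      by (simp add: koszul_diff_add koszul_diff_scale koszul_diff_diff[OF S])
    finally have "x l * (c S - koszul_diff N f r S) =
        koszul_diff N f y S + koszul_wedge g (koszul_diff N f c) S"
      using hom[OF S] by (simp add: algebra_simps)
    also have "\<dots> \<in> ?J"
      using wd[OF S] r S unfolding y_def
      by (intro ideal.span_add koszul_diff_in_ideal) auto
    finally show ?thesis using reg step.hyps unfolding regular_sequence_def by blast
  qed
  then show ?case by blast
qed

text \<open>
  A syzygy is a Koszul cycle of degree 1, and the case \<open>l = 0\<close> of exactness makes it a boundary.
  The entry of a boundary at \<open>i\<close> only involves the \<open>f j\<close> with \<open>j \<noteq> i\<close>.
\<close>

theorem syzygy_entry_in_ideal_of_others:
  fixes f x p :: "nat \<Rightarrow> 'a::comm_ring_1"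
  assumes reg: "regular_sequence N x"
    and x: "\<And>k. k < N \<Longrightarrow> \<exists>g. x k = (\<Sum>j<N. g j * f j)"
    and syz: "(\<Sum>j<N. p j * f j) = 0" and "i < N"
  shows "\<exists>b. p i = (\<Sum>j\<in>{..<N} - {i}. b j * f j)"
proof -
  define c where "c S = (if card S = 1 then p (the_elem S) else 0)" for S
  have "koszul_diff N f c S = 0" if S: "S \<subseteq> {..<N}" for S
  proof (cases "S = {}")
    case True
    then show ?thesis using syz by (simp add: koszul_diff_def koszul_sign_def c_def mult.commute)
  next
    case False
    have "card (insert j S) \<noteq> 1" if "j \<in> {..<N} - S" for j
      using that False finite_subset[OF S] by auto
    then show ?thesis by (simp add: koszul_diff_def c_def)
  qed
  then obtain b where b: "\<forall>S\<subseteq>{..<N}. c S - koszul_diff N f b S \<in> ideal.span (x ` {..<0})"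
    using koszul_exact_mod_regular[OF reg x, of 0 c] by (auto simp: c_def)
  then have "p i = koszul_diff N f b {i}" using \<open>i < N\<close> by (auto simp: c_def)
  also have "\<dots> = (\<Sum>j\<in>{..<N} - {i}. (koszul_sign j {i} * b {j, i}) * f j)"
    unfolding koszul_diff_def by (intro sum.cong) (simp_all add: mult_ac)
  finally show ?thesis by (intro exI[of _ "\<lambda>j. koszul_sign j {i} * b {j, i}"])
qed

section \<open>Evaluation of polynomials\<close>

lemma sum_of_monomials: "(\<Sum>m\<in>Poly_Mapping.keys p. Poly_Mapping.single m (Poly_Mapping.lookup p m)) = p"
  by (rule poly_mapping_eqI) (simp add: lookup_sum lookup_single when_def in_keys_iff)

lemma poly_mapping_monomial_induct [case_names monomial add]:
  assumes "\<And>m a. P (Poly_Mapping.single m a)" "\<And>p q. P p \<Longrightarrow> P q \<Longrightarrow> P (p + q)"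
  shows "P (p :: 'a \<Rightarrow>\<^sub>0 'b::comm_monoid_add)"
proof -
  have "P (\<Sum>m\<in>A. Poly_Mapping.single m (Poly_Mapping.lookup p m))" if "finite A" for A
    using that
  proof (induction A rule: finite_induct)
    case empty
    show ?case using assms(1)[of undefined 0] by simp
  qed (simp add: assms)
  from this[OF finite_keys[of p]] show ?thesis by (simp only: sum_of_monomials)
qed

text \<open>
  Constants and variables generate the ring, which is what identifies a residue map with the
  evaluation at a point once it is known on the variables.
\<close>

lemma cpoly_induct [case_names const var add mult]:
  assumes const: "\<And>a. P (const_poly a)" and var: "\<And>w. P (var_poly w)"
    and add: "\<And>p q. P p \<Longrightarrow> P q \<Longrightarrow> P (p + q)"
    and mult: "\<And>p q. P p \<Longrightarrow> P q \<Longrightarrow> P (p * q)"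
  shows "P p"
proof (induction p rule: poly_mapping_monomial_induct)
  case (monomial m a)
  have one: "P (Poly_Mapping.single (0 :: nat \<Rightarrow>\<^sub>0 nat) 1)" using const[of 1] by (simp add: const_poly_def)
  have "P (Poly_Mapping.single m 1)"
  proof (induction m rule: poly_mapping_monomial_induct)
    case (monomial w k)
    show ?case
    proof (induction k)
      case (Suc k)
      have "Poly_Mapping.single (Poly_Mapping.single w (Suc k)) 1 =
          var_poly w * Poly_Mapping.single (Poly_Mapping.single w k) 1"
        by (simp add: var_poly_def mult_single flip: single_add)
      then show ?case using mult[OF var Suc] by simp
    qed (use one in simp)
  next
    case (add m m')
    then show ?case using mult[of "Poly_Mapping.single m 1" "Poly_Mapping.single m' 1"]
      by (simp add: mult_single)
  qed
  then have "P (const_poly a * Poly_Mapping.single m 1)" by (rule mult[OF const])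
  then show ?case by (simp add: const_poly_def mult_single)
qed (rule add)

definition eval_monomial :: "(nat \<Rightarrow> complex) \<Rightarrow> (nat \<Rightarrow>\<^sub>0 nat) \<Rightarrow> complex" where
  "eval_monomial z m = (\<Prod>w\<in>Poly_Mapping.keys m. z w ^ Poly_Mapping.lookup m w)"

lemma eval_monomial_superset:
  "finite A \<Longrightarrow> Poly_Mapping.keys m \<subseteq> A \<Longrightarrow>
     eval_monomial z m = (\<Prod>w\<in>A. z w ^ Poly_Mapping.lookup m w)"
  unfolding eval_monomial_def by (rule prod.mono_neutral_left) (auto simp: in_keys_iff)

lemma eval_monomial_add: "eval_monomial z (m + m') = eval_monomial z m * eval_monomial z m'"
proof -
  let ?A = "Poly_Mapping.keys m \<union> Poly_Mapping.keys m'"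
  have "Poly_Mapping.keys (m + m') \<subseteq> ?A" by (rule keys_add)
  then show ?thesis
    by (simp add: eval_monomial_superset[of ?A] lookup_add power_add prod.distrib)
qed

lemma eval_poly_superset:
  "finite A \<Longrightarrow> Poly_Mapping.keys p \<subseteq> A \<Longrightarrow>
     eval_poly p z = (\<Sum>m\<in>A. Poly_Mapping.lookup p m * eval_monomial z m)"
  unfolding eval_poly_def eval_monomial_def by (rule sum.mono_neutral_left) (auto simp: in_keys_iff)

lemma eval_poly_single [simp]: "eval_poly (Poly_Mapping.single m a) z = a * eval_monomial z m"
  by (subst eval_poly_superset[of "{m}"]) (auto simp: in_keys_iff lookup_single when_def)

lemma eval_poly_0 [simp]: "eval_poly 0 z = 0"
  by (simp add: eval_poly_def)

lemma eval_poly_add [simp]: "eval_poly (p + q) z = eval_poly p z + eval_poly q z"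
proof -
  let ?A = "Poly_Mapping.keys p \<union> Poly_Mapping.keys q"
  have "Poly_Mapping.keys (p + q) \<subseteq> ?A" by (rule keys_add)
  then show ?thesis
    by (simp add: eval_poly_superset[of ?A] lookup_add distrib_right sum.distrib)
qed

lemma eval_poly_mult [simp]: "eval_poly (p * q) z = eval_poly p z * eval_poly q z"
proof (induction p rule: poly_mapping_monomial_induct)
  case (monomial m a)
  show ?case
    by (induction q rule: poly_mapping_monomial_induct)
       (simp_all add: mult_single eval_monomial_add distrib_left)
qed (simp add: distrib_right)

lemma eval_poly_const [simp]: "eval_poly (const_poly a) z = a"
  by (simp add: const_poly_def eval_monomial_def)

lemma eval_poly_var [simp]: "eval_poly (var_poly w) z = z w"
  by (simp add: var_poly_def eval_monomial_def)

lemma eval_poly_1 [simp]: "eval_poly 1 z = 1"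
  using eval_poly_const[of 1 z] by (simp add: const_poly_def)

lemma eval_poly_sum [simp]: "eval_poly (sum p A) z = (\<Sum>i\<in>A. eval_poly (p i) z)"
  by (induction A rule: infinite_finite_induct) simp_all

lemma const_poly_add: "const_poly (a + b) = const_poly a + const_poly b"
  and const_poly_mult: "const_poly (a * b) = const_poly a * const_poly b"
  and const_poly_0: "const_poly 0 = 0"
  and const_poly_1: "const_poly 1 = 1"
  by (simp_all add: const_poly_def single_add mult_single)

lemma const_poly_uminus: "const_poly (- a) = - const_poly a"
  by (simp add: const_poly_def single_uminus)

lemma const_poly_of_int: "const_poly (of_int k) = of_int k"
  by (simp add: const_poly_def)

section \<open>The Nullstellensatz over an uncountable field\<close>

interpretation cpoly_vs: vector_space "\<lambda>a p. const_poly a * p"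
  by unfold_locales
    (simp_all add: const_poly_add const_poly_mult const_poly_1 algebra_simps)

lemma countable_exponents: "countable (UNIV :: (nat \<Rightarrow>\<^sub>0 nat) set)"
proof -
  have "m = Poly_Mapping.nth (map (Poly_Mapping.lookup m) [0..<Poly_Mapping.degree m])"
    for m :: "nat \<Rightarrow>\<^sub>0 nat"
    by (rule poly_mapping_eqI) (auto simp: nth_default_def beyond_degree_lookup_zero)
  then have "UNIV = Poly_Mapping.nth ` (UNIV :: nat list set)" by blast
  then show ?thesis by (metis countable_image uncountable_def countableI_type)
qed

text \<open>
  There are only countably many monomials, so uncountably many polynomials cannot be independent:
  infinitely many of them would lie in the span of finitely many monomials.
\<close>

lemma uncountable_family_dependent:
  fixes u :: "complex \<Rightarrow> cpoly"
  assumes "uncountable C"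
  shows "\<exists>T \<alpha>. finite T \<and> T \<subseteq> C \<and> (\<Sum>c\<in>T. const_poly (\<alpha> c) * u c) = 0 \<and> (\<exists>c\<in>T. \<alpha> c \<noteq> 0)"
proof -
  let ?e = "from_nat_into (UNIV :: (nat \<Rightarrow>\<^sub>0 nat) set)"
  define B :: "nat \<Rightarrow> cpoly set" where "B k = (\<lambda>j. Poly_Mapping.single (?e j) 1) ` {..<k}" for k
  have "\<exists>k. u c \<in> cpoly_vs.span (B k)" for c
  proof -
    obtain k where k: "Poly_Mapping.keys (u c) \<subseteq> ?e ` {..<k}"
    proof -
      define K where "K = Suc (Max (to_nat_on (UNIV :: (nat \<Rightarrow>\<^sub>0 nat) set) ` Poly_Mapping.keys (u c)))"
      have "m \<in> ?e ` {..<K}" if "m \<in> Poly_Mapping.keys (u c)" for m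
      proof (rule image_eqI)
        show "m = ?e (to_nat_on UNIV m)" using countable_exponents by simp
        show "to_nat_on (UNIV :: (nat \<Rightarrow>\<^sub>0 nat) set) m \<in> {..<K}"
          using that by (simp add: K_def less_Suc_eq_le)
      qed
      then show ?thesis using that by blast
    qed
    have "(\<Sum>m\<in>Poly_Mapping.keys (u c). const_poly (Poly_Mapping.lookup (u c) m) * Poly_Mapping.single m 1)
        \<in> cpoly_vs.span (B k)"
      using k unfolding B_def
      by (intro cpoly_vs.span_sum cpoly_vs.span_scale cpoly_vs.span_base) blast
    then have "u c \<in> cpoly_vs.span (B k)"
      by (simp add: const_poly_def mult_single sum_of_monomials)
    then show ?thesis ..
  qed
  then have C: "C = (\<Union>k. {c \<in> C. u c \<in> cpoly_vs.span (B k)})" by blast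
  have "\<exists>k. uncountable {c \<in> C. u c \<in> cpoly_vs.span (B k)}"
  proof (rule ccontr)
    assume "\<nexists>k. uncountable {c \<in> C. u c \<in> cpoly_vs.span (B k)}"
    then have "countable (\<Union>k. {c \<in> C. u c \<in> cpoly_vs.span (B k)})" by (intro countable_UN) auto
    then show False using assms C by simp
  qed
  then obtain k where unc: "uncountable {c \<in> C. u c \<in> cpoly_vs.span (B k)}" ..
  define D where "D = {c \<in> C. u c \<in> cpoly_vs.span (B k)}"
  have inf: "infinite D" using unc unfolding D_def using countable_finite by blast
  show ?thesis
  proof (cases "inj_on u D")
    case False
    then obtain c c' where "c \<in> D" "c' \<in> D" "c \<noteq> c'" "u c = u c'" unfolding inj_on_def by blast
    then show ?thesis
      by (intro exI[of _ "{c, c'}"] exI[of _ "\<lambda>x. if x = c then 1 else - 1"])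
        (auto simp: D_def const_poly_uminus const_poly_1)
  next
    case True
    have "cpoly_vs.dependent (u ` D)"
    proof (rule ccontr)
      assume "\<not> ?thesis"
      moreover have "u ` D \<subseteq> cpoly_vs.span (B k)" by (auto simp: D_def)
      moreover have "finite (B k)" by (simp add: B_def)
      ultimately have "finite (u ` D)" using cpoly_vs.independent_span_bound by blast
      then show False using inf True finite_imageD by blast
    qed
    then obtain V \<beta> where V: "finite V" "V \<subseteq> u ` D"
        "(\<Sum>v\<in>V. const_poly (\<beta> v) * v) = 0" "\<exists>v\<in>V. \<beta> v \<noteq> 0"
      unfolding cpoly_vs.dependent_explicit by blast
    obtain T where T: "T \<subseteq> D" "V = u ` T" "inj_on u T"
      using V(2) True by (metis inj_on_subset subset_imageE)
    have "finite T" using V(1) T finite_imageD by blast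
    then show ?thesis using V T
      by (intro exI[of _ T] exI[of _ "\<lambda>c. \<beta> (u c)"]) (auto simp: D_def sum.reindex)
  qed
qed

text \<open>
  Zorn's lemma. Maximality means that in the localization of the quotient at \<open>s\<close> every nonzero
  element is invertible; the last conclusion states this without forming the localization.
\<close>

lemma ideal_maximal_avoiding_powers:
  fixes s :: "'a::comm_ring_1"
  assumes I: "ideal.subspace I" and s: "\<And>m. s ^ m \<notin> I"
  obtains J where "ideal.subspace J" "I \<subseteq> J" "\<And>m. s ^ m \<notin> J"
    "\<And>p. p \<notin> J \<Longrightarrow> \<exists>m q. s ^ m - q * p \<in> J"
proof -
  let ?A = "{J. ideal.subspace J \<and> I \<subseteq> J \<and> (\<forall>m. s ^ m \<notin> J)}"
  have "\<exists>M\<in>?A. \<forall>X\<in>?A. M \<subseteq> X \<longrightarrow> X = M"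
  proof (rule subset_Zorn_nonempty)
    show "?A \<noteq> {}" using I s by blast
    fix \<C> assume ne: "\<C> \<noteq> {}" and chain: "subset.chain ?A \<C>"
    have sub: "\<And>X. X \<in> \<C> \<Longrightarrow> ideal.subspace X \<and> I \<subseteq> X \<and> (\<forall>m. s ^ m \<notin> X)"
      and tot: "\<And>X Y. X \<in> \<C> \<Longrightarrow> Y \<in> \<C> \<Longrightarrow> X \<subseteq> Y \<or> Y \<subseteq> X"
      using chain unfolding subset_chain_def by auto
    obtain X0 where X0: "X0 \<in> \<C>" using ne by blast
    have "ideal.subspace (\<Union>\<C>)"
    proof (rule ideal.subspaceI)
      show "0 \<in> \<Union>\<C>" using X0 sub ideal.subspace_0 by (intro UnionI) auto
    next
      fix x y assume "x \<in> \<Union>\<C>" "y \<in> \<Union>\<C>"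
      then obtain Z where Z: "Z \<in> \<C>" "x \<in> Z" "y \<in> Z" using tot by blast
      then have "x + y \<in> Z" using sub by (intro ideal.subspace_add) auto
      then show "x + y \<in> \<Union>\<C>" using Z by blast
    next
      fix c x assume "x \<in> \<Union>\<C>"
      then obtain X where X: "X \<in> \<C>" "x \<in> X" by blast
      then have "c * x \<in> X" using sub by (intro ideal.subspace_scale) auto
      then show "c * x \<in> \<Union>\<C>" using X by blast
    qed
    then show "\<Union>\<C> \<in> ?A" using sub X0 by auto
  qed
  then obtain J where JA: "J \<in> ?A" and max: "\<forall>X\<in>?A. J \<subseteq> X \<longrightarrow> X = J" by (rule bexE)
  from JA have J: "ideal.subspace J" "I \<subseteq> J" "\<And>m. s ^ m \<notin> J" by simp_all
  have "\<exists>m q. s ^ m - q * p \<in> J" if "p \<notin> J" for p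
  proof -
    let ?K = "ideal.span (insert p J)"
    have "insert p J \<subseteq> ?K" by (rule ideal.span_superset)
    then have K: "J \<subseteq> ?K" "?K \<noteq> J" using that by auto
    have "\<exists>m. s ^ m \<in> ?K"
    proof (rule ccontr)
      assume "\<not> ?thesis"
      then have "?K \<in> ?A" using K(1) J(2) by auto
      then show False using max K by simp
    qed
    moreover have "ideal.span J = J" using J(1) by simp
    ultimately show ?thesis by (auto simp: ideal.span_breakdown_eq)
  qed
  with J show ?thesis by (rule that)
qed

lemma maximal_avoiding_powers_prime:
  fixes s :: "'a::comm_ring_1"
  assumes J: "ideal.subspace J" "\<And>m. s ^ m \<notin> J"
    and max: "\<And>p. p \<notin> J \<Longrightarrow> \<exists>m q. s ^ m - q * p \<in> J"
    and pq: "p * q \<in> J"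
  shows "p \<in> J \<or> q \<in> J"
proof (rule ccontr)
  assume "\<not> ?thesis"
  then obtain m k a b where mk: "s ^ m - a * p \<in> J" "s ^ k - b * q \<in> J" using max by metis
  have "s ^ (m + k) = s ^ k * (s ^ m - a * p) + (a * p) * (s ^ k - b * q) + (a * b) * (p * q)"
    by (simp add: power_add algebra_simps)
  also have "\<dots> \<in> J"
    by (intro ideal.subspace_add[OF J(1)] ideal.subspace_scale[OF J(1) mk(1)]
        ideal.subspace_scale[OF J(1) mk(2)] ideal.subspace_scale[OF J(1) pq])
  finally show False using J(2) by blast
qed

definition subst_poly :: "complex poly \<Rightarrow> cpoly \<Rightarrow> cpoly" where
  "subst_poly R t = poly (map_poly const_poly R) t"

lemma subst_poly_0 [simp]: "subst_poly 0 t = 0"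
  by (simp add: subst_poly_def)

lemma subst_poly_pCons [simp]: "subst_poly (pCons a R) t = const_poly a + t * subst_poly R t"
  by (simp add: subst_poly_def map_poly_pCons const_poly_0)

lemma subst_poly_add: "subst_poly (R + Q) t = subst_poly R t + subst_poly Q t"
  by (induction R Q rule: poly_induct2) (simp_all add: const_poly_add algebra_simps)

lemma subst_poly_smult: "subst_poly (smult a R) t = const_poly a * subst_poly R t"
  by (induction R) (simp_all add: const_poly_mult algebra_simps)

lemma subst_poly_mult: "subst_poly (R * Q) t = subst_poly R t * subst_poly Q t"
  by (induction R) (simp_all add: subst_poly_add subst_poly_smult const_poly_0 algebra_simps)

lemma subst_poly_sum: "subst_poly (sum R A) t = (\<Sum>i\<in>A. subst_poly (R i) t)"
  by (induction A rule: infinite_finite_induct) (simp_all add: subst_poly_add)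

lemma subst_poly_prod: "subst_poly (prod R A) t = (\<Prod>i\<in>A. subst_poly (R i) t)"
  by (induction A rule: infinite_finite_induct)
    (simp_all add: subst_poly_mult const_poly_1 one_pCons)

text \<open>
  A residue that is algebraic over the complex numbers is a complex number, because a nonzero
  polynomial in one variable splits into linear factors and one of them lies in the prime ideal.
\<close>

lemma linear_factor_in_prime_ideal:
  assumes J: "ideal.subspace J" "1 \<notin> J"
    and prime: "\<And>p q. p * q \<in> J \<Longrightarrow> p \<in> J \<or> q \<in> J"
    and "R \<noteq> 0" "subst_poly R t \<in> J"
  shows "\<exists>c. t - const_poly c \<in> J"
  using assms(4,5)
proof (induction "degree R" arbitrary: R)
  case 0
  then obtain a where R: "R = [:a:]" using degree_eq_zeroE by metis
  then have "const_poly (inverse a) * const_poly a \<in> J"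
    using 0 by (intro ideal.subspace_scale[OF J(1)]) simp
  then show ?case using 0 R J(2) by (simp add: const_poly_1 flip: const_poly_mult)
next
  case (Suc k)
  then have "\<not> constant (poly R)" by (simp add: constant_degree)
  then obtain c where "poly R c = 0" using fundamental_theorem_of_algebra by blast
  then obtain Q where R: "R = [:- c, 1:] * Q" by (auto simp: poly_eq_0_iff_dvd)
  have lin: "subst_poly [:- c, 1:] t = t - const_poly c"
    by (simp add: const_poly_uminus const_poly_1)
  have "(t - const_poly c) * subst_poly Q t \<in> J" using Suc.prems R lin by (simp only: subst_poly_mult)
  then consider "t - const_poly c \<in> J" | "subst_poly Q t \<in> J" using prime by blast
  then show ?case
  proof cases
    case 2
    have "Q \<noteq> 0" using Suc.prems R by auto
    moreover have "k = degree Q" 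
      using Suc.hyps(2) degree_mult_eq[OF _ \<open>Q \<noteq> 0\<close>, of "[:- c, 1:]"] R by simp
    ultimately show ?thesis using Suc.hyps(1) 2 by blast
  qed blast
qed

text \<open>
  If no \<open>t - c\<close> were in \<open>J\<close>, each would have an inverse up to a power of \<open>s\<close>, say
  \<open>u\<^sub>c (t - c) \<equiv> s\<^sup>m\<close>, with the same \<open>m\<close> for uncountably many \<open>c\<close>. A linear relation among these \<open>u\<^sub>c\<close>,
  multiplied by the product of the \<open>t - c\<close>, gives a nonzero polynomial \<open>R\<close> with \<open>s\<^sup>m R(t) \<in> J\<close>. Then
  \<open>R(t) \<in> J\<close>, and some linear factor of it is in \<open>J\<close> after all.
\<close>

lemma constant_mod_maximal_avoiding_powers:
  fixes s t :: cpoly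
  assumes J: "ideal.subspace J" "\<And>m. s ^ m \<notin> J"
    and max: "\<And>p. p \<notin> J \<Longrightarrow> \<exists>m q. s ^ m - q * p \<in> J"
  shows "\<exists>c. t - const_poly c \<in> J"
proof (rule ccontr)
  assume contr: "\<not> ?thesis"
  have prime: "p \<in> J \<or> q \<in> J" if "p * q \<in> J" for p q
    using maximal_avoiding_powers_prime[OF J max that] .
  have "\<forall>c. \<exists>m u. s ^ m - u * (t - const_poly c) \<in> J" using contr max by blast
  then obtain m u where mu: "\<And>c. s ^ m c - u c * (t - const_poly c) \<in> J" by metis
  have "\<exists>k. uncountable {c. m c = k}"
  proof (rule ccontr)
    assume "\<nexists>k. uncountable {c. m c = k}"
    then have "countable (\<Union>k. {c. m c = k})" by (intro countable_UN) auto
    moreover have "(\<Union>k. {c. m c = k}) = (UNIV :: complex set)" by blast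
    ultimately show False using uncountable_UNIV_complex by simp
  qed
  then obtain k where unc: "uncountable {c. m c = k}" ..
  obtain T \<alpha> where T: "finite T" "T \<subseteq> {c. m c = k}"
      "(\<Sum>c\<in>T. const_poly (\<alpha> c) * u c) = 0" "\<exists>c\<in>T. \<alpha> c \<noteq> 0"
    using uncountable_family_dependent[OF unc, of u] by (elim exE conjE) (rule that)
  define R where "R = (\<Sum>c\<in>T. smult (\<alpha> c) (\<Prod>b\<in>T - {c}. [:- b, 1:]))"
  define L where "L b = t - const_poly b" for b
  have lin: "subst_poly [:- b, 1:] t = L b" for b
    by (simp add: L_def const_poly_uminus const_poly_1)
  have R: "subst_poly R t = (\<Sum>c\<in>T. const_poly (\<alpha> c) * (\<Prod>b\<in>T - {c}. L b))"
    unfolding R_def subst_poly_sum subst_poly_smult subst_poly_prod lin ..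
  obtain c0 where c0: "c0 \<in> T" "\<alpha> c0 \<noteq> 0" using T by blast
  \<comment> \<open>Only the summand of \<open>c0\<close> survives at the point \<open>c0\<close>.\<close>
  have "poly R c0 = (\<Sum>c\<in>T. \<alpha> c * (\<Prod>b\<in>T - {c}. c0 - b))"
    by (simp add: R_def poly_sum poly_prod)
  also have "\<dots> = \<alpha> c0 * (\<Prod>b\<in>T - {c0}. c0 - b) + (\<Sum>c\<in>T - {c0}. \<alpha> c * (\<Prod>b\<in>T - {c}. c0 - b))"
    using T c0 by (simp add: sum.remove)
  also have "(\<Sum>c\<in>T - {c0}. \<alpha> c * (\<Prod>b\<in>T - {c}. c0 - b)) = 0"
    using T(1) c0 by (intro sum.neutral) (auto simp: prod_zero_iff)
  finally have "poly R c0 \<noteq> 0" using T(1) c0 by (auto simp: prod_zero_iff)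
  then have "R \<noteq> 0" by auto
  have split: "s ^ k * (const_poly (\<alpha> c) * (\<Prod>b\<in>T - {c}. L b)) =
      (const_poly (\<alpha> c) * (\<Prod>b\<in>T - {c}. L b)) * (s ^ m c - u c * L c)
      + (const_poly (\<alpha> c) * u c) * (\<Prod>b\<in>T. L b)" if "c \<in> T" for c
  proof -
    have "(\<Prod>b\<in>T. L b) = L c * (\<Prod>b\<in>T - {c}. L b)" using T(1) that by (rule prod.remove)
    moreover have "m c = k" using T(2) that by blast
    ultimately show ?thesis by (simp add: algebra_simps)
  qed
  have "s ^ k * subst_poly R t = (\<Sum>c\<in>T. s ^ k * (const_poly (\<alpha> c) * (\<Prod>b\<in>T - {c}. L b)))"
    by (simp add: R sum_distrib_left)
  also have "\<dots> = (\<Sum>c\<in>T. (const_poly (\<alpha> c) * (\<Prod>b\<in>T - {c}. L b)) * (s ^ m c - u c * L c))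
      + (\<Sum>c\<in>T. const_poly (\<alpha> c) * u c) * (\<Prod>b\<in>T. L b)"
    by (simp add: split sum.distrib sum_distrib_right)
  also have "\<dots> = (\<Sum>c\<in>T. (const_poly (\<alpha> c) * (\<Prod>b\<in>T - {c}. L b)) * (s ^ m c - u c * L c))"
    by (simp add: T)
  also have "\<dots> \<in> J"
    unfolding L_def
    by (intro ideal.subspace_sum[OF J(1)] ideal.subspace_scale[OF J(1) mu])
  finally have "subst_poly R t \<in> J" using prime J(2) by blast
  moreover have "1 \<notin> J" using J(2)[of 0] by simp
  ultimately show False
    using linear_factor_in_prime_ideal[OF J(1) _ prime \<open>R \<noteq> 0\<close>] contr by blast
qed

text \<open>
  Modulo a maximal ideal avoiding the powers of \<open>s\<close>, each variable is a constant. These constants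
  form a point at which the whole ideal vanishes, while \<open>s\<close>, being outside the ideal, does not.
  The argument works for infinitely many variables, as long as they are countably many.
\<close>

theorem nullstellensatz:
  fixes I :: "cpoly set"
  assumes "ideal.subspace I" "\<And>m. s ^ m \<notin> I"
  shows "\<exists>z. (\<forall>p\<in>I. eval_poly p z = 0) \<and> eval_poly s z \<noteq> 0"
proof -
  obtain J where J: "ideal.subspace J" "I \<subseteq> J" "\<And>m. s ^ m \<notin> J"
    and max: "\<And>p. p \<notin> J \<Longrightarrow> \<exists>m q. s ^ m - q * p \<in> J"
    using ideal_maximal_avoiding_powers[OF assms] by metis
  have "\<forall>w. \<exists>c. var_poly w - const_poly c \<in> J"
    using constant_mod_maximal_avoiding_powers[OF J(1,3) max] by blast
  then obtain z where z: "\<And>w. var_poly w - const_poly (z w) \<in> J" by metis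
  have ev: "p - const_poly (eval_poly p z) \<in> J" for p
  proof (induction p rule: cpoly_induct)
    case (const a)
    then show ?case using ideal.subspace_0[OF J(1)] by simp
  next
    case (var w)
    then show ?case using z by simp
  next
    case (add p q)
    have "p + q - const_poly (eval_poly (p + q) z) =
        (p - const_poly (eval_poly p z)) + (q - const_poly (eval_poly q z))"
      by (simp add: const_poly_add)
    then show ?case using add ideal.subspace_add[OF J(1)] by metis
  next
    case (mult p q)
    have "p * q - const_poly (eval_poly (p * q) z) =
        q * (p - const_poly (eval_poly p z)) + const_poly (eval_poly p z) * (q - const_poly (eval_poly q z))"
      by (simp add: const_poly_mult algebra_simps)
    then show ?case using mult ideal.subspace_add[OF J(1)] ideal.subspace_scale[OF J(1)] by metis
  qed
  have unit: "a = 0" if "const_poly a \<in> J" for a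
  proof (rule ccontr)
    assume "a \<noteq> 0"
    then have "const_poly (inverse a) * const_poly a = s ^ 0"
      by (simp add: const_poly_1 flip: const_poly_mult)
    then show False using ideal.subspace_scale[OF J(1) that] J(3) by metis
  qed
  have "eval_poly p z = 0" if "p \<in> J" for p
  proof -
    have "p - (p - const_poly (eval_poly p z)) \<in> J" using ideal.subspace_diff[OF J(1) that ev] .
    then show ?thesis using unit by simp
  qed
  moreover have "eval_poly s z \<noteq> 0" using ev[of s] J(3)[of 1] by (auto simp: const_poly_0)
  ultimately show ?thesis using J(2) by blast
qed

section \<open>Powers of the variables and partial derivatives\<close>

lemma lookup_single_mult:
  fixes q :: "'a::cancel_comm_monoid_add \<Rightarrow>\<^sub>0 'b::comm_semiring_0"
  shows "Poly_Mapping.lookup (Poly_Mapping.single s a * q) (s + m) = a * Poly_Mapping.lookup q m"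
  by (induction q rule: poly_mapping_monomial_induct)
    (auto simp: mult_single lookup_single when_def lookup_add distrib_left)

lemma var_poly_power: "var_poly w ^ k = Poly_Mapping.single (Poly_Mapping.single w k) 1"
  by (induction k) (simp_all add: var_poly_def mult_single flip: single_add)

lemma minus_add_single:
  "k \<le> Poly_Mapping.lookup (m :: 'a \<Rightarrow>\<^sub>0 nat) w \<Longrightarrow> Poly_Mapping.single w k + (m - Poly_Mapping.single w k) = m"
  by (rule poly_mapping_eqI) (auto simp: lookup_add lookup_minus lookup_single when_def)

text \<open>
  A polynomial lies in a monomial ideal exactly when each of its monomials does.
\<close>

lemma variable_power_ideal:
  "p \<in> ideal.span ((\<lambda>k. var_poly k ^ e k) ` {..<l}) \<longleftrightarrow>
     (\<forall>m\<in>Poly_Mapping.keys p. \<exists>k<l. e k \<le> Poly_Mapping.lookup m k)"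
  (is "p \<in> ?J \<longleftrightarrow> (\<forall>m\<in>Poly_Mapping.keys p. ?Q m)")
proof -
  let ?M = "{p :: cpoly. \<forall>m\<in>Poly_Mapping.keys p. ?Q m}"
  have "ideal.subspace ?M"
  proof (rule ideal.subspaceI)
    fix c p assume p: "p \<in> ?M"
    show "c * p \<in> ?M"
    proof (intro CollectI ballI)
      fix m assume "m \<in> Poly_Mapping.keys (c * p)"
      then obtain r s where rs: "m = r + s" "s \<in> Poly_Mapping.keys p" using keys_mult[of c p] by blast
      then obtain k where "k < l" "e k \<le> Poly_Mapping.lookup s k" using p by blast
      then show "\<exists>k<l. e k \<le> Poly_Mapping.lookup m k" using rs by (auto simp: lookup_add intro!: exI[of _ k])
    qed
  next
    fix p q assume "p \<in> ?M" "q \<in> ?M"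
    then show "p + q \<in> ?M" using keys_add[of p q] by blast
  qed simp
  moreover have "(\<lambda>k. var_poly k ^ e k) ` {..<l} \<subseteq> ?M"
    by (auto simp: var_poly_power)
  ultimately have "?J \<subseteq> ?M" by (intro ideal.span_minimal)
  moreover have "p \<in> ?J" if "p \<in> ?M"
  proof -
  have "Poly_Mapping.single m (Poly_Mapping.lookup p m) \<in> ?J" if m: "m \<in> Poly_Mapping.keys p" for m
  proof -
    obtain k where k: "k < l" "e k \<le> Poly_Mapping.lookup m k" using m \<open>p \<in> ?M\<close> by blast
    have "Poly_Mapping.single (m - Poly_Mapping.single k (e k)) (Poly_Mapping.lookup p m) * var_poly k ^ e k \<in> ?J"
      using k by (intro ideal.span_scale ideal.span_base) blast
    then show ?thesis using minus_add_single[OF k(2)]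
      by (simp add: var_poly_power mult_single add.commute)
  qed
  then have "(\<Sum>m\<in>Poly_Mapping.keys p. Poly_Mapping.single m (Poly_Mapping.lookup p m)) \<in> ?J"
    by (rule ideal.span_sum)
  then show "p \<in> ?J" by (simp only: sum_of_monomials)
  qed
  ultimately show ?thesis by blast
qed

text \<open>
  Multiplication by \<open>z\<^sub>l\<^sup>e\<close> shifts exponent vectors in the direction \<open>l\<close>, which does not affect
  divisibility by powers of the variables before \<open>l\<close>.
\<close>

lemma variable_powers_regular: "regular_sequence N (\<lambda>k. var_poly k ^ e k)"
  unfolding regular_sequence_def variable_power_ideal
proof (intro allI impI ballI)
  fix l q m
  assume q: "\<forall>m\<in>Poly_Mapping.keys (var_poly l ^ e l * q). \<exists>k<l. e k \<le> Poly_Mapping.lookup m k"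
    and m: "m \<in> Poly_Mapping.keys q"
  have "Poly_Mapping.single l (e l) + m \<in> Poly_Mapping.keys (var_poly l ^ e l * q)"
    using m by (simp add: var_poly_power in_keys_iff lookup_single_mult)
  then obtain k where "k < l" "e k \<le> Poly_Mapping.lookup (Poly_Mapping.single l (e l) + m) k"
    using q by blast
  then show "\<exists>k<l. e k \<le> Poly_Mapping.lookup m k"
    by (auto simp: lookup_add lookup_single when_def)
qed

lemma lookup_partial_poly:
  "Poly_Mapping.lookup (partial_poly w p) m =
     of_nat (Poly_Mapping.lookup m w + 1) * Poly_Mapping.lookup p (Poly_Mapping.single w 1 + m)"
proof -
  let ?m' = "Poly_Mapping.single w 1 + m"
  have "Poly_Mapping.lookup (partial_poly w p) m = (\<Sum>k\<in>Poly_Mapping.keys p.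
      if k = ?m' then of_nat (Poly_Mapping.lookup k w) * Poly_Mapping.lookup p k else 0)"
    unfolding partial_poly_def lookup_sum
  proof (rule sum.cong[OF refl])
    fix k
    have "(k - Poly_Mapping.single w 1 = m) \<longleftrightarrow> k = ?m'" if "Poly_Mapping.lookup k w \<noteq> 0"
      using minus_add_single[of 1 k w] that by force
    moreover have "Poly_Mapping.lookup ?m' w \<noteq> 0" by (simp add: lookup_add)
    ultimately show "Poly_Mapping.lookup (Poly_Mapping.single (k - Poly_Mapping.single w 1)
          (of_nat (Poly_Mapping.lookup k w) * Poly_Mapping.lookup p k)) m =
        (if k = ?m' then of_nat (Poly_Mapping.lookup k w) * Poly_Mapping.lookup p k else 0)"
      by (cases "Poly_Mapping.lookup k w = 0") (auto simp: lookup_single when_def)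
  qed
  also have "\<dots> = of_nat (Poly_Mapping.lookup ?m' w) * Poly_Mapping.lookup p ?m'"
    by (simp add: in_keys_iff)
  finally show ?thesis by (simp add: lookup_add)
qed

lemma lookup_var_partial_poly:
  "Poly_Mapping.lookup (var_poly w * partial_poly w p) m =
     of_nat (Poly_Mapping.lookup m w) * Poly_Mapping.lookup p m"
proof (cases "Poly_Mapping.lookup m w = 0")
  case True
  have "m \<notin> Poly_Mapping.keys (var_poly w * partial_poly w p)"
    using keys_mult[of "var_poly w" "partial_poly w p"] True
    by (auto simp: var_poly_def lookup_add)
  then show ?thesis using True by (simp add: in_keys_iff)
next
  case False
  let ?m' = "m - Poly_Mapping.single w 1"
  have m: "Poly_Mapping.single w 1 + ?m' = m" using False by (intro minus_add_single) simp
  have "Poly_Mapping.lookup (var_poly w * partial_poly w p) (Poly_Mapping.single w 1 + ?m') =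
      Poly_Mapping.lookup (partial_poly w p) ?m'"
    unfolding var_poly_def lookup_single_mult by simp
  also have "\<dots> = of_nat (Poly_Mapping.lookup ?m' w + 1) * Poly_Mapping.lookup p m"
    unfolding lookup_partial_poly m ..
  also have "Poly_Mapping.lookup ?m' w + 1 = Poly_Mapping.lookup m w"
    using False by (simp add: lookup_minus)
  finally show ?thesis unfolding m .
qed

lemma lookup_of_int_mult:
  "Poly_Mapping.lookup (of_int c * p) m = of_int c * Poly_Mapping.lookup (p :: cpoly) m"
  using lookup_single_mult[of 0 "of_int c" p m] by simp

text \<open>
  The operators \<open>z\<^sub>w \<partial>/\<partial>z\<^sub>w\<close> are diagonal in the monomial basis, with the exponent of \<open>w\<close> as eigenvalue.
\<close>

lemma euler_relation:
  assumes f: "f \<in> coord_ring n"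
    and hom: "\<And>m. m \<in> Poly_Mapping.keys f \<Longrightarrow>
      (\<Sum>w\<in>Poly_Mapping.keys m. int (Poly_Mapping.lookup m w) * wt w) = c"
  shows "(\<Sum>w<n + 2. (of_int (wt w) * var_poly w) * partial_poly w f) = of_int c * f"
proof (rule poly_mapping_eqI)
  fix m
  have "Poly_Mapping.lookup (\<Sum>w<n + 2. (of_int (wt w) * var_poly w) * partial_poly w f) m =
      (\<Sum>w<n + 2. of_int (int (Poly_Mapping.lookup m w) * wt w)) * Poly_Mapping.lookup f m"
    unfolding lookup_sum sum_distrib_right mult.assoc lookup_of_int_mult lookup_var_partial_poly
    by (intro sum.cong refl) simp
  also have "\<dots> = of_int c * Poly_Mapping.lookup f m"
  proof (cases "m \<in> Poly_Mapping.keys f")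
    case True
    have "Poly_Mapping.keys m \<subseteq> {..<n + 2}" using f True by (auto simp: coord_ring_def)
    then have "(\<Sum>w<n + 2. int (Poly_Mapping.lookup m w) * wt w) =
        (\<Sum>w\<in>Poly_Mapping.keys m. int (Poly_Mapping.lookup m w) * wt w)"
      by (intro sum.mono_neutral_right) (auto simp: in_keys_iff)
    then have "(\<Sum>w<n + 2. int (Poly_Mapping.lookup m w) * wt w) = c" using hom[OF True] by simp
    then show ?thesis by (simp only: of_int_sum[symmetric])
  qed (simp add: in_keys_iff)
  finally show "Poly_Mapping.lookup (\<Sum>w<n + 2. (of_int (wt w) * var_poly w) * partial_poly w f) m =
      Poly_Mapping.lookup (of_int c * f) m" by (simp add: lookup_of_int_mult)
qed

section \<open>Bidegrees and fields annihilating a quasi-smooth equation\<close>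

lemma monom_bideg_superset:
  assumes "finite A" "Poly_Mapping.keys m \<subseteq> A"
  shows "monom_bideg a m = (\<Sum>w\<in>A. int (Poly_Mapping.lookup m w) * fst (var_bideg a w),
     \<Sum>w\<in>A. int (Poly_Mapping.lookup m w) * snd (var_bideg a w))"
  unfolding monom_bideg_def prod.inject
  by (intro conjI sum.mono_neutral_left assms) (auto simp: in_keys_iff)

lemma monom_bideg_add: "monom_bideg a (m + m') = monom_bideg a m + monom_bideg a m'"
proof -
  let ?A = "Poly_Mapping.keys m \<union> Poly_Mapping.keys m'"
  have "Poly_Mapping.keys (m + m') \<subseteq> ?A" by (rule keys_add)
  then show ?thesis
    by (simp add: monom_bideg_superset[of ?A] lookup_add distrib_right sum.distrib)
qed

lemma monom_bideg_single: "monom_bideg a (Poly_Mapping.single w 1) = var_bideg a w"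
  by (simp add: monom_bideg_def)

lemma keys_add_nat:
  "Poly_Mapping.keys (m + m') = Poly_Mapping.keys m \<union> Poly_Mapping.keys (m' :: 'a \<Rightarrow>\<^sub>0 nat)"
  by (auto simp: in_keys_iff lookup_add)

lemma quasi_homogeneous_0 [simp]: "quasi_homogeneous n a e 0"
  by (simp add: quasi_homogeneous_def coord_ring_def)

lemma quasi_homogeneous_add:
  "quasi_homogeneous n a e p \<Longrightarrow> quasi_homogeneous n a e q \<Longrightarrow> quasi_homogeneous n a e (p + q)"
  using keys_add[of p q] unfolding quasi_homogeneous_def coord_ring_def by blast

lemma quasi_homogeneous_sum:
  "(\<And>i. i \<in> A \<Longrightarrow> quasi_homogeneous n a e (p i)) \<Longrightarrow> quasi_homogeneous n a e (sum p A)"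
  by (induction A rule: infinite_finite_induct) (auto intro: quasi_homogeneous_add)

lemma coord_ring_mult:
  assumes "p \<in> coord_ring n" "q \<in> coord_ring n"
  shows "p * q \<in> coord_ring n"
  using keys_mult[of p q] assms unfolding coord_ring_def by (fastforce simp: keys_add_nat)

lemma quasi_homogeneous_mult:
  assumes "quasi_homogeneous n a e p" "quasi_homogeneous n a e' q"
  shows "quasi_homogeneous n a (e + e') (p * q)"
  using keys_mult[of p q] assms unfolding quasi_homogeneous_def
  by (fastforce simp: monom_bideg_add intro: coord_ring_mult)

lemma quasi_homogeneous_const: "quasi_homogeneous n a 0 (const_poly c)"
  by (auto simp: quasi_homogeneous_def coord_ring_def const_poly_def monom_bideg_def zero_prod_def)

lemma quasi_homogeneous_var: "w < n + 2 \<Longrightarrow> quasi_homogeneous n a (var_bideg a w) (var_poly w)"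
  using monom_bideg_single
  by (simp add: quasi_homogeneous_def coord_ring_def var_poly_def)

lemma quasi_homogeneous_unique:
  "quasi_homogeneous n a e p \<Longrightarrow> quasi_homogeneous n a e' p \<Longrightarrow> p \<noteq> 0 \<Longrightarrow> e = e'"
  unfolding quasi_homogeneous_def by (metis ex_in_conv keys_eq_empty)

lemma quasi_homogeneous_partial:
  assumes "quasi_homogeneous n a e f"
  shows "quasi_homogeneous n a (e - var_bideg a w) (partial_poly w f)"
proof -
  have "Poly_Mapping.keys m \<subseteq> {..<n + 2} \<and> monom_bideg a m = e - var_bideg a w"
    if m: "m \<in> Poly_Mapping.keys (partial_poly w f)" for m
  proof -
    have "Poly_Mapping.single w 1 + m \<in> Poly_Mapping.keys f"
      using m by (simp add: in_keys_iff lookup_partial_poly)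
    then have "Poly_Mapping.keys (Poly_Mapping.single w 1 + m) \<subseteq> {..<n + 2}"
        "monom_bideg a (Poly_Mapping.single w 1 + m) = e"
      using assms unfolding quasi_homogeneous_def coord_ring_def by auto
    then show ?thesis unfolding monom_bideg_add monom_bideg_single keys_add_nat by auto
  qed
  then show ?thesis unfolding quasi_homogeneous_def coord_ring_def by blast
qed

lemma apply_radial1:
  assumes "quasi_homogeneous n a e f"
  shows "apply_field n (radial1 n a) f = of_int (fst e) * f"
proof -
  have "apply_field n (radial1 n a) f =
      (\<Sum>w<n + 2. (of_int (fst (var_bideg a w)) * var_poly w) * partial_poly w f)"
    unfolding apply_field_def by (intro sum.cong refl) (auto simp: radial1_def var_bideg_def)
  also have "\<dots> = of_int (fst e) * f"
    using assms by (intro euler_relation) (auto simp: quasi_homogeneous_def monom_bideg_def)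
  finally show ?thesis .
qed

lemma apply_radial2:
  assumes "quasi_homogeneous n a e f"
  shows "apply_field n (radial2 n) f = of_int (snd e) * f"
proof -
  have "apply_field n (radial2 n) f =
      (\<Sum>w<n + 2. (of_int (snd (var_bideg a w)) * var_poly w) * partial_poly w f)"
    unfolding apply_field_def by (intro sum.cong refl) (auto simp: radial2_def var_bideg_def)
  also have "\<dots> = of_int (snd e) * f"
    using assms by (intro euler_relation) (auto simp: quasi_homogeneous_def monom_bideg_def)
  finally show ?thesis .
qed

text \<open>
  The second degree is nonnegative on all variables and excludes the \<open>z\<^sub>2\<^sub>,\<^sub>i\<close>; on the remaining two
  variables the first degree is positive. So only the constant monomial has bidegree \<open>(0, 0)\<close>,
  whatever the signs of the \<open>a i\<close>.
\<close>

lemma quasi_homogeneous_bideg_0_const: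
  assumes "quasi_homogeneous n a 0 f"
  shows "\<exists>c. f = const_poly c"
proof -
  have "m = 0" if m: "m \<in> Poly_Mapping.keys f" for m
  proof -
    let ?l = "Poly_Mapping.lookup m"
    have deg: "(\<Sum>w\<in>Poly_Mapping.keys m. int (?l w) * fst (var_bideg a w)) = 0"
        "(\<Sum>w\<in>Poly_Mapping.keys m. int (?l w) * snd (var_bideg a w)) = 0"
      using assms m by (auto simp: quasi_homogeneous_def monom_bideg_def zero_prod_def)
    have "int (?l w) * snd (var_bideg a w) = 0" if "w \<in> Poly_Mapping.keys m" for w
      using deg(2) that by (subst (asm) sum_nonneg_eq_0_iff) (auto simp: var_bideg_def)
    then have small: "w < 2" if "w \<in> Poly_Mapping.keys m" for w
      using that by (force simp: var_bideg_def in_keys_iff split: if_splits)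
    then have "(\<Sum>w\<in>Poly_Mapping.keys m. int (?l w)) = 0"
      using deg(1) by (simp add: var_bideg_def cong: sum.cong)
    then have "\<forall>w\<in>Poly_Mapping.keys m. int (?l w) = 0"
      by (subst (asm) sum_nonneg_eq_0_iff) auto
    then show "m = 0" by (intro poly_mapping_eqI) (auto simp: in_keys_iff)
  qed
  then have "f = const_poly (Poly_Mapping.lookup f 0)"
    by (intro poly_mapping_eqI) (auto simp: const_poly_def lookup_single when_def in_keys_iff)
  then show ?thesis ..
qed

definition truncate_point :: "nat \<Rightarrow> (nat \<Rightarrow> complex) \<Rightarrow> nat \<Rightarrow> complex" where
  "truncate_point n z w = (if w < n + 2 then z w else 0)"

lemma truncate_point_coord_space [simp]: "truncate_point n z \<in> coord_space n"
  by (simp add: truncate_point_def coord_space_def)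

lemma eval_poly_truncate_point:
  assumes "p \<in> coord_ring n"
  shows "eval_poly p (truncate_point n z) = eval_poly p z"
  unfolding eval_poly_def using assms
  by (intro sum.cong refl arg_cong2[where f = "(*)"] prod.cong)
    (auto simp: coord_ring_def truncate_point_def)

text \<open>
  As \<open>e \<noteq> 0\<close>, one of the two Euler relations expresses \<open>f\<close> through its partial derivatives, so by
  strong quasi-smoothness the partial derivatives vanish simultaneously at most at the origin. The
  Nullstellensatz turns this into membership of powers of the variables in their ideal. Replacing the
  coordinates beyond the first \<open>n + 2\<close> of the point it provides by 0 changes no value of a polynomial
  in the coordinate ring.
\<close>

lemma partials_generate_variable_power:
  assumes f: "quasi_homogeneous n a e f" "e \<noteq> 0" and smooth: "strongly_quasi_smooth n f"
    and "k < n + 2"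
  shows "\<exists>m g. var_poly k ^ m = (\<Sum>j<n + 2. g j * partial_poly j f)"
proof (rule ccontr)
  assume none: "\<not> ?thesis"
  let ?I = "{p. \<exists>g. p = (\<Sum>j<n + 2. g j * partial_poly j f)}"
  have "ideal.subspace ?I"
  proof (rule ideal.subspaceI)
    show "0 \<in> ?I" by (auto intro!: exI[of _ "\<lambda>_. 0"])
  next
    fix p q assume "p \<in> ?I" "q \<in> ?I"
    then obtain g h where "p = (\<Sum>j<n + 2. g j * partial_poly j f)"
        "q = (\<Sum>j<n + 2. h j * partial_poly j f)" by blast
    then have "p + q = (\<Sum>j<n + 2. (g j + h j) * partial_poly j f)"
      by (simp only: distrib_right sum.distrib)
    then show "p + q \<in> ?I" by (intro CollectI exI[of _ "\<lambda>j. g j + h j"])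
  next
    fix c p assume "p \<in> ?I"
    then obtain g where "p = (\<Sum>j<n + 2. g j * partial_poly j f)" by blast
    then have "c * p = (\<Sum>j<n + 2. (c * g j) * partial_poly j f)"
      by (simp only: sum_distrib_left mult.assoc)
    then show "c * p \<in> ?I" by (intro CollectI exI[of _ "\<lambda>j. c * g j"])
  qed
  moreover have "var_poly k ^ m \<notin> ?I" for m using none by blast
  ultimately obtain z where z: "\<And>p. p \<in> ?I \<Longrightarrow> eval_poly p z = 0" "eval_poly (var_poly k) z \<noteq> 0"
    using nullstellensatz[of ?I "var_poly k"] by auto
  have part: "eval_poly (partial_poly w f) z = 0" if "w < n + 2" for w
  proof (rule z(1))
    have "partial_poly w f = (\<Sum>j<n + 2. (if j = w then 1 else 0) * partial_poly j f)"
      using that by (subst sum.remove[of _ w]) auto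
    then show "partial_poly w f \<in> ?I" by (intro CollectI exI[of _ "\<lambda>j. if j = w then 1 else 0"])
  qed
  have app: "eval_poly (apply_field n R f) z = 0" for R
    by (simp only: apply_field_def eval_poly_sum eval_poly_mult) (intro sum.neutral, simp add: part)
  have "of_int (fst e) * eval_poly f z = 0" "of_int (snd e) * eval_poly f z = 0"
    using app[of "radial1 n a"] app[of "radial2 n"]
    unfolding apply_radial1[OF f(1)] apply_radial2[OF f(1)] by (simp_all flip: const_poly_of_int)
  then have "eval_poly f z = 0" using f(2) by (auto simp: prod_eq_iff)
  moreover have "f \<in> coord_ring n" "\<And>w. partial_poly w f \<in> coord_ring n"
    using f(1) quasi_homogeneous_partial[OF f(1)] unfolding quasi_homogeneous_def by blast+
  ultimately have "eval_poly f (truncate_point n z) = 0"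
      "\<forall>w<n + 2. eval_poly (partial_poly w f) (truncate_point n z) = 0"
    using part by (simp_all add: eval_poly_truncate_point)
  moreover have "truncate_point n z \<noteq> (\<lambda>_. 0)"
    using z(2) \<open>k < n + 2\<close> by (auto simp: truncate_point_def fun_eq_iff)
  then have "truncate_point n z \<in> coord_space n - {\<lambda>_. 0}" by simp
  ultimately show False using smooth unfolding strongly_quasi_smooth_def by blast
qed

text \<open>
  The entries of \<open>Y\<close> form a syzygy of the partial derivatives, whose ideal contains the regular
  sequence of variable powers. So \<open>Y i\<close> is a combination of the \<open>\<partial>f/\<partial>z\<^sub>j\<close> with \<open>j \<noteq> i\<close>. Comparing the
  bidegree of a monomial of \<open>Y i\<close> with that of the factor coming from some \<open>\<partial>f/\<partial>z\<^sub>j\<close> leaves a cofactor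
  monomial \<open>m\<close>.
\<close>

lemma bidegree_of_annihilating_field:
  assumes f: "quasi_homogeneous n a e f" "e \<noteq> 0" and smooth: "strongly_quasi_smooth n f"
    and Y: "\<And>w. w < n + 2 \<Longrightarrow> quasi_homogeneous n a (d + var_bideg a w) (Y w)"
    and kill: "apply_field n Y f = 0" and i: "i < n + 2" "Y i \<noteq> 0"
  shows "\<exists>j m. j < n + 2 \<and> j \<noteq> i \<and> Poly_Mapping.keys m \<subseteq> {..<n + 2} \<and>
     d + var_bideg a i + var_bideg a j = e + monom_bideg a m"
proof -
  have "\<forall>k. \<exists>m. k < n + 2 \<longrightarrow> (\<exists>g. var_poly k ^ m = (\<Sum>j<n + 2. g j * partial_poly j f))"
    using partials_generate_variable_power[OF f smooth] by blast
  then obtain \<mu> where \<mu>: "\<And>k. k < n + 2 \<Longrightarrow> \<exists>g. var_poly k ^ \<mu> k = (\<Sum>j<n + 2. g j * partial_poly j f)"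
    by metis
  obtain b where b: "Y i = (\<Sum>j\<in>{..<n + 2} - {i}. b j * partial_poly j f)"
    using syzygy_entry_in_ideal_of_others[OF variable_powers_regular \<mu> _ i(1), of Y] kill
    unfolding apply_field_def by blast
  obtain s where s: "s \<in> Poly_Mapping.keys (Y i)" using i(2) by (metis ex_in_conv keys_eq_empty)
  then obtain j where j: "j < n + 2" "j \<noteq> i" "s \<in> Poly_Mapping.keys (b j * partial_poly j f)"
    using keys_sum[of "\<lambda>j. b j * partial_poly j f" "{..<n + 2} - {i}"] unfolding b by blast
  then obtain m r where mr: "s = m + r" "r \<in> Poly_Mapping.keys (partial_poly j f)"
    using keys_mult[of "b j" "partial_poly j f"] by blast
  have "Poly_Mapping.keys s \<subseteq> {..<n + 2}" "monom_bideg a s = d + var_bideg a i"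
    using Y[OF i(1)] s unfolding quasi_homogeneous_def coord_ring_def by auto
  moreover have "monom_bideg a r = e - var_bideg a j"
    using quasi_homogeneous_partial[OF f(1)] mr(2) unfolding quasi_homogeneous_def by blast
  ultimately have "Poly_Mapping.keys m \<subseteq> {..<n + 2}"
      "d + var_bideg a i + var_bideg a j = e + monom_bideg a m"
    using mr(1) by (auto simp: keys_add_nat monom_bideg_add algebra_simps)
  then show ?thesis using j by blast
qed

section \<open>Irreducibility of the scroll\<close>

text \<open>
  A nonzero element of a domain is not nilpotent, so this is the Nullstellensatz for the zero ideal.
\<close>

lemma nonzero_poly_nonvanishing_point:
  assumes "p \<in> coord_ring n" "p \<noteq> 0"
  shows "\<exists>z\<in>coord_space n. eval_poly p z \<noteq> 0"
proof -
  obtain z where "eval_poly p z \<noteq> 0" using nullstellensatz[of "{0}" p] assms(2) by auto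
  then show ?thesis using assms(1)
    by (intro bexI[of _ "truncate_point n z"]) (simp_all add: eval_poly_truncate_point)
qed

text \<open>
  The complements of hypersurfaces are closed under finite intersections, since the product of two
  equations cuts out the union of the hypersurfaces. So this subbasis is a basis.
\<close>

lemma coord_zariski_basis:
  assumes "openin (coord_zariski n) U" "x \<in> U"
  shows "\<exists>p\<in>coord_ring n. eval_poly p x \<noteq> 0 \<and> {z \<in> coord_space n. eval_poly p z \<noteq> 0} \<subseteq> U"
proof -
  have "generate_topology_on {{z \<in> coord_space n. eval_poly p z \<noteq> 0} | p. p \<in> coord_ring n} U"
    using assms(1) unfolding coord_zariski_def openin_topology_generated_by_iff .
  then show ?thesis using assms(2)
  proof (induction rule: generate_topology_on.induct)
    case (Int U V)
    then obtain p q where "p \<in> coord_ring n" "eval_poly p x \<noteq> 0"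
        "{z \<in> coord_space n. eval_poly p z \<noteq> 0} \<subseteq> U"
        "q \<in> coord_ring n" "eval_poly q x \<noteq> 0" "{z \<in> coord_space n. eval_poly q z \<noteq> 0} \<subseteq> V"
      by blast
    then show ?case by (intro bexI[of _ "p * q"]) (auto simp: coord_ring_mult)
  next
    case (UN K)
    then obtain k where k: "k \<in> K" "x \<in> k" by blast
    with UN.IH obtain p where "p \<in> coord_ring n" "eval_poly p x \<noteq> 0"
        "{z \<in> coord_space n. eval_poly p z \<noteq> 0} \<subseteq> k" by blast
    then show ?case using k by (intro bexI[of _ p]) auto
  qed auto
qed

lemma var_poly_coord_ring: "w < n + 2 \<Longrightarrow> var_poly w \<in> coord_ring n"
  by (simp add: coord_ring_def var_poly_def)

text \<open>
  The coordinate ring is a domain, so finitely many nonzero polynomials have a common point of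
  nonvanishing. Including the product of \<open>z\<^sub>1\<^sub>,\<^sub>1\<close> and \<open>z\<^sub>2\<^sub>,\<^sub>1\<close> among them keeps the point off the
  exceptional set.
\<close>

lemma scroll_cover_open_sets_meet:
  assumes "1 \<le> n"
    and U: "openin (subtopology (coord_zariski n) (scroll_cover n)) U" "U \<noteq> {}"
    and V: "openin (subtopology (coord_zariski n) (scroll_cover n)) V" "V \<noteq> {}"
  shows "U \<inter> V \<noteq> {}"
proof -
  obtain U' V' where U': "openin (coord_zariski n) U'" "U = U' \<inter> scroll_cover n"
    and V': "openin (coord_zariski n) V'" "V = V' \<inter> scroll_cover n"
    using U(1) V(1) unfolding openin_subtopology by blast
  obtain x y where xy: "x \<in> U'" "y \<in> V'" using U(2) V(2) U' V' by blast
  obtain p where p: "p \<in> coord_ring n" "eval_poly p x \<noteq> 0"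
      "{z \<in> coord_space n. eval_poly p z \<noteq> 0} \<subseteq> U'"
    using coord_zariski_basis[OF U'(1) xy(1)] by blast
  obtain q where q: "q \<in> coord_ring n" "eval_poly q y \<noteq> 0"
      "{z \<in> coord_space n. eval_poly q z \<noteq> 0} \<subseteq> V'"
    using coord_zariski_basis[OF V'(1) xy(2)] by blast
  have "p \<noteq> 0" "q \<noteq> 0" using p(2) q(2) by auto
  moreover have "var_poly w \<noteq> 0" for w using eval_poly_var[of w "\<lambda>_. 1"] by (metis eval_poly_0 zero_neq_one)
  ultimately have "p * q * (var_poly 0 * var_poly 2) \<noteq> 0" by simp
  moreover have "p * q * (var_poly 0 * var_poly 2) \<in> coord_ring n"
    using p q \<open>1 \<le> n\<close> by (intro coord_ring_mult var_poly_coord_ring) auto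
  ultimately obtain z where z: "z \<in> coord_space n"
      "eval_poly (p * q * (var_poly 0 * var_poly 2)) z \<noteq> 0"
    using nonzero_poly_nonvanishing_point by blast
  then have nz: "eval_poly p z \<noteq> 0" "eval_poly q z \<noteq> 0" "z 0 \<noteq> 0" "z 2 \<noteq> 0" by auto
  have "z \<in> scroll_cover n"
    using z(1) nz(3,4) \<open>1 \<le> n\<close> unfolding scroll_cover_def exceptional_set_def
    by (auto intro!: bexI[of _ 1] simp: numeral_2_eq_2)
  moreover have "z \<in> U'" "z \<in> V'" using p(3) q(3) z(1) nz by auto
  ultimately show ?thesis using U' V' by blast
qed

lemma topspace_coord_zariski: "topspace (coord_zariski n) = coord_space n"
proof -
  have "1 \<in> coord_ring n" by (simp add: coord_ring_def)
  moreover have "coord_space n = {z \<in> coord_space n. eval_poly 1 z \<noteq> 0}" by simp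
  ultimately have "coord_space n \<in> {{z \<in> coord_space n. eval_poly p z \<noteq> 0} | p. p \<in> coord_ring n}"
    by blast
  then show ?thesis unfolding coord_zariski_def topology_generated_by_topspace by blast
qed

lemma topspace_scroll_zariski: "topspace (scroll_zariski n a) = scroll n a"
proof
  show "topspace (scroll_zariski n a) \<subseteq> scroll n a"
    using openin_topspace[of "scroll_zariski n a"] unfolding openin_scroll_zariski by blast
  have "scroll_cover n \<subseteq> topspace (coord_zariski n)"
    by (auto simp: topspace_coord_zariski scroll_cover_def)
  moreover have "{z \<in> scroll_cover n. torus_orbit a z \<in> scroll n a} = scroll_cover n"
    by (auto simp: scroll_def)
  ultimately have "openin (scroll_zariski n a) (scroll n a)"
    unfolding openin_scroll_zariski using openin_topspace[of "subtopology (coord_zariski n) (scroll_cover n)"]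
    by (simp add: topspace_subtopology inf.absorb2)
  then show "scroll n a \<subseteq> topspace (scroll_zariski n a)" by (rule openin_subset)
qed

lemma irreducible_scroll:
  assumes "1 \<le> n"
  shows "irreducible_closedin (scroll_zariski n a) (scroll n a)"
  unfolding irreducible_closedin_def
proof (intro conjI allI impI)
  let ?pre = "\<lambda>T. {z \<in> scroll_cover n. torus_orbit a z \<in> T}"
  show "closedin (scroll_zariski n a) (scroll n a)"
    using closedin_topspace[of "scroll_zariski n a"] by (simp add: topspace_scroll_zariski)
  have "(\<lambda>w. if w < n + 2 then 1 else 0) \<in> scroll_cover n"
    using assms unfolding scroll_cover_def exceptional_set_def coord_space_def
    by (auto intro!: bexI[of _ 1])
  then show "scroll n a \<noteq> {}" by (auto simp: scroll_def)
  fix A B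
  assume AB: "closedin (scroll_zariski n a) A \<and> closedin (scroll_zariski n a) B \<and> scroll n a = A \<union> B"
  show "scroll n a = A \<or> scroll n a = B"
  proof (rule ccontr)
    assume neq: "\<not> ?thesis"
    have "openin (scroll_zariski n a) (scroll n a - A)" "openin (scroll_zariski n a) (scroll n a - B)"
      using AB unfolding closedin_def topspace_scroll_zariski by auto
    moreover have pre: "?pre T \<noteq> {}" if "T \<subseteq> scroll n a" "T \<noteq> {}" for T
      using that unfolding scroll_def by blast
    have "scroll n a - A \<noteq> {}" "scroll n a - B \<noteq> {}" using neq AB by blast+
    then have "?pre (scroll n a - A) \<noteq> {}" "?pre (scroll n a - B) \<noteq> {}"
      using pre[OF Diff_subset] by blast+
    ultimately have "?pre (scroll n a - A) \<inter> ?pre (scroll n a - B) \<noteq> {}"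
      unfolding openin_scroll_zariski by (intro scroll_cover_open_sets_meet[OF assms]) auto
    then show False using AB by blast
  qed
qed

lemma codim_closed_topspace:
  assumes "irreducible_closedin T (topspace T)"
  shows "codim_closed T (topspace T) = 0"
proof -
  have "k = 0" if C: "C 0 = topspace T" "\<forall>i\<le>k. irreducible_closedin T (C i)" "\<forall>i<k. C i \<subset> C (Suc i)"
    for k :: nat and C
  proof (rule ccontr)
    assume "k \<noteq> 0"
    then have "C 0 \<subset> C (Suc 0)" "closedin T (C (Suc 0))"
      using C(2,3) by (auto simp: irreducible_closedin_def)
    then show False using C(1) closedin_subset by blast
  qed
  then have "codim_irreducible T (topspace T) \<le> 0"
    unfolding codim_irreducible_def by (intro Sup_least) (auto simp: zero_enat_def)
  moreover have "codim_closed T (topspace T) \<le> codim_irreducible T (topspace T)"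
    unfolding codim_closed_def using assms by (intro Inf_lower) auto
  ultimately show ?thesis by simp
qed

text \<open>
  If \<open>X\<close> were a combination of the radial fields, so would be every field of its class, and the wedge
  product with \<open>R\<^sub>1 \<and> R\<^sub>2\<close> would vanish everywhere. The singular set would then be the whole irreducible
  scroll, of codimension 0.
\<close>

lemma foliation_not_radial:
  assumes "1 \<le> n" and F: "foliation n a d F" and "X \<in> F"
  shows "\<not> (\<forall>w. X w = g1 * radial1 n a w + g2 * radial2 n w)"
proof
  assume X: "\<forall>w. X w = g1 * radial1 n a w + g2 * radial2 n w"
  obtain X0 where X0: "F = field_class n a d X0" using F unfolding foliation_def by blast
  obtain h1 h2 where h: "\<And>w. X w = X0 w + h1 * radial1 n a w + h2 * radial2 n w"
    using \<open>X \<in> F\<close> unfolding X0 field_class_def by blast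
  have "wedge3_coeff (\<lambda>i. eval_poly (radial1 n a i) z) (\<lambda>i. eval_poly (radial2 n i) z)
      (\<lambda>i. eval_poly (Z i) z) u v w = 0" if Z: "Z \<in> F" for Z z u v w
  proof -
    obtain k1 k2 where k: "\<And>w. Z w = X0 w + k1 * radial1 n a w + k2 * radial2 n w"
      using Z unfolding X0 field_class_def by blast
    have Zi: "Z i = (g1 - h1 + k1) * radial1 n a i + (g2 - h2 + k2) * radial2 n i" for i
      using X[rule_format, of i] h[of i] k[of i] by (simp add: algebra_simps)
    show ?thesis unfolding wedge3_coeff_def Zi eval_poly_add eval_poly_mult by algebra
  qed
  then have "sing_set n a F = topspace (scroll_zariski n a)"
    unfolding sing_set_def topspace_scroll_zariski scroll_def by simp
  then have "codim_closed (scroll_zariski n a) (sing_set n a F) = 0"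
    using codim_closed_topspace[of "scroll_zariski n a"] irreducible_scroll[OF \<open>1 \<le> n\<close>]
    by (simp add: topspace_scroll_zariski)
  then show False using F unfolding foliation_def by simp
qed

section \<open>The degree bounds\<close>

lemma quasi_homogeneous_apply_field:
  assumes X: "qh_vector_field n a d X" and f: "quasi_homogeneous n a e f"
  shows "quasi_homogeneous n a (d + e) (apply_field n X f)"
  unfolding apply_field_def
proof (rule quasi_homogeneous_sum)
  fix w assume "w \<in> {..<n + 2}"
  then have "quasi_homogeneous n a (d + var_bideg a w) (X w)"
    using X unfolding qh_vector_field_def by blast
  from quasi_homogeneous_mult[OF this quasi_homogeneous_partial[OF f, of w]]
  show "quasi_homogeneous n a (d + e) (X w * partial_poly w f)" by simp
qed

lemma quasi_homogeneous_of_int_var: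
  assumes "w < n + 2"
  shows "quasi_homogeneous n a (var_bideg a w) (of_int c * var_poly w)"
  using quasi_homogeneous_mult[OF quasi_homogeneous_const[of n a "of_int c"]
      quasi_homogeneous_var[OF assms, of a]]
  by (simp add: const_poly_of_int)

text \<open>
  Which radial field to use depends on which component of the bidegree is nonzero. Writing it as a
  combination of both allows the two cases to be treated together afterwards.
\<close>

lemma nonzero_radial_eigenvalue:
  assumes f: "quasi_homogeneous n a e f" "e \<noteq> 0"
  obtains R r g1 g2 where "\<And>w. R w = g1 * radial1 n a w + g2 * radial2 n w"
    "\<And>w. w < n + 2 \<Longrightarrow> quasi_homogeneous n a (var_bideg a w) (R w)"
    "r \<noteq> 0" "apply_field n R f = of_int r * f"
proof (cases "fst e = 0")
  case False
  have "quasi_homogeneous n a (var_bideg a w) (radial1 n a w)" if "w < n + 2" for w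
    using quasi_homogeneous_of_int_var[OF that, of a "if w < 2 then 1 else - a (w - 1)"] that
    by (auto simp: radial1_def split: if_splits)
  then show ?thesis
    using False apply_radial1[OF f(1)] by (intro that[of "radial1 n a" 1 0 "fst e"]) auto
next
  case True
  then have "snd e \<noteq> 0" using f(2) by (simp add: prod_eq_iff)
  moreover have "quasi_homogeneous n a (var_bideg a w) (radial2 n w)" if "w < n + 2" for w
    using quasi_homogeneous_var[OF that, of a] that by (auto simp: radial2_def)
  ultimately show ?thesis
    using apply_radial2[OF f(1)] by (intro that[of "radial2 n" 0 1 "snd e"]) auto
qed

text \<open>
  If \<open>X f = g f\<close> and \<open>R f = r f\<close> with a number \<open>r \<noteq> 0\<close>, then \<open>X - (g / r) R\<close> annihilates \<open>f\<close>. It is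
  homogeneous of the bidegree of \<open>X\<close> because \<open>g f = X f\<close> forces \<open>g\<close> to have bidegree \<open>d\<close>, and it is not
  zero because \<open>X\<close> is not radial.
\<close>

lemma annihilating_field_of_invariant_hypersurface:
  assumes X: "qh_vector_field n a d X"
    and not_radial: "\<And>g1 g2. \<not> (\<forall>w. X w = g1 * radial1 n a w + g2 * radial2 n w)"
    and f: "quasi_homogeneous n a e f" "e \<noteq> 0" "f \<noteq> 0"
    and inv: "invariant_hypersurface n a X f"
  shows "\<exists>Y i. (\<forall>w<n + 2. quasi_homogeneous n a (d + var_bideg a w) (Y w)) \<and>
     apply_field n Y f = 0 \<and> i < n + 2 \<and> Y i \<noteq> 0"
proof -
  obtain g c where g: "quasi_homogeneous n a c g" "apply_field n X f = g * f"
    using inv unfolding invariant_hypersurface_def by blast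
  have gd: "quasi_homogeneous n a d g"
  proof (cases "g = 0")
    case False
    have "quasi_homogeneous n a (d + e) (g * f)"
      using quasi_homogeneous_apply_field[OF X f(1)] g(2) by simp
    then have "d + e = c + e"
      using quasi_homogeneous_unique[OF _ quasi_homogeneous_mult[OF g(1) f(1)]] False f(3) by simp
    then show ?thesis using g(1) by simp
  qed simp
  obtain R r g1 g2 where R: "\<And>w. R w = g1 * radial1 n a w + g2 * radial2 n w"
    "\<And>w. w < n + 2 \<Longrightarrow> quasi_homogeneous n a (var_bideg a w) (R w)"
    "r \<noteq> 0" "apply_field n R f = of_int r * f"
    using nonzero_radial_eigenvalue[OF f(1,2)] by metis
  define h where "h = const_poly (- 1 / of_int r) * g"
  define Y where "Y w = X w + h * R w" for w
  have h: "h * of_int r = - g"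
  proof -
    have "h * of_int r = const_poly (- 1 / of_int r * of_int r) * g"
      unfolding h_def const_poly_mult const_poly_of_int by (simp add: mult_ac)
    then show ?thesis using R(3) by (simp add: const_poly_uminus const_poly_1)
  qed
  have hd: "quasi_homogeneous n a d h"
    using quasi_homogeneous_mult[OF quasi_homogeneous_const gd] unfolding h_def add_0_left .
  have "quasi_homogeneous n a (d + var_bideg a w) (Y w)" if "w < n + 2" for w
    using X that unfolding Y_def qh_vector_field_def
    by (intro quasi_homogeneous_add quasi_homogeneous_mult hd R(2)) auto
  moreover have "apply_field n Y f = 0"
  proof -
    have "apply_field n Y f = apply_field n X f + h * apply_field n R f"
      unfolding apply_field_def Y_def sum_distrib_left
      by (simp only: distrib_right sum.distrib mult.assoc)
    also have "\<dots> = g * f + (h * of_int r) * f" by (simp only: g(2) R(4) mult.assoc)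
    finally show ?thesis by (simp add: h)
  qed
  moreover have "\<exists>i<n + 2. Y i \<noteq> 0"
  proof (rule ccontr)
    assume none: "\<not> ?thesis"
    have "X w = (- h * g1) * radial1 n a w + (- h * g2) * radial2 n w" for w
    proof (cases "w < n + 2")
      case True
      then have "X w + h * R w = 0" using none unfolding Y_def by blast
      then show ?thesis unfolding R(1) by (simp add: algebra_simps eq_neg_iff_add_eq_0)
    next
      case False
      then show ?thesis using X by (simp add: qh_vector_field_def radial1_def radial2_def)
    qed
    then show False using not_radial by blast
  qed
  ultimately show ?thesis by blast
qed

lemma fibre_coordinate_index: "w < n + 2 \<Longrightarrow> \<not> w < 2 \<Longrightarrow> (w::nat) - 1 \<in> {1..n}"
  unfolding atLeastAtMost_iff by linarith

lemma snd_monom_bideg_nonneg: "0 \<le> snd (monom_bideg a m)"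
  by (auto simp: monom_bideg_def var_bideg_def intro!: sum_nonneg)

lemma fst_monom_bideg_nonneg:
  assumes "Poly_Mapping.keys m \<subseteq> {..<n + 2}" "\<forall>i\<in>{1..n}. a i \<le> 0"
  shows "0 \<le> fst (monom_bideg a m)"
proof -
  have "0 \<le> fst (var_bideg a w)" if "w \<in> Poly_Mapping.keys m" for w
  proof -
    have "w < n + 2" using assms(1) that by auto
    then show ?thesis
      using assms(2) fibre_coordinate_index[of w n] by (auto simp: var_bideg_def simp del: One_nat_def)
  qed
  then show ?thesis by (auto simp: monom_bideg_def intro!: sum_nonneg)
qed

text \<open>
  The pairs of fibre coordinates contribute the numbers \<open>- (a k + a l)\<close> themselves. A pair with a base
  coordinate, whose first degree is 1, is dominated: \<open>1 \<le> - a l\<close> for some negative \<open>a l\<close> with a prescribed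
  index excluded, since there are two negative ones.
\<close>

lemma fst_var_bideg_pair_le:
  fixes a :: "nat \<Rightarrow> int"
  assumes ij: "i < n + 2" "j < n + 2" "i \<noteq> j" and neg: "\<forall>i\<in>{1..n}. a i \<le> 0"
    and two: "p \<in> {1..n}" "q \<in> {1..n}" "p \<noteq> q" "a p < 0" "a q < 0"
  shows "fst (var_bideg a i) + fst (var_bideg a j) \<le> - Min {a i + a j | i j. 1 \<le> i \<and> i < j \<and> j \<le> n}"
    (is "_ \<le> - Min ?S")
proof -
  have "?S \<subseteq> (\<lambda>(i, j). a i + a j) ` ({1..n} \<times> {1..n})" by force
  then have fin: "finite ?S" by (rule finite_subset) simp
  have pair: "Min ?S \<le> a k + a l" if "k \<in> {1..n}" "l \<in> {1..n}" "k \<noteq> l" for k l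
  proof (cases "k < l")
    case True
    then show ?thesis using fin that by (intro Min_le) auto
  next
    case False
    then have "a l + a k \<in> ?S" using that by force
    then show ?thesis using fin by (simp add: add.commute)
  qed
  have single: "1 - a k \<le> - Min ?S" if k: "k \<in> {1..n}" for k
  proof -
    obtain l where "l \<in> {1..n}" "l \<noteq> k" "a l < 0" using two by metis
    then show ?thesis using pair[OF k, of l] by linarith
  qed
  have "1 + 1 \<le> - Min ?S" using single[OF two(1)] two(4) by linarith
  moreover note fibre_coordinate_index[OF ij(1)] fibre_coordinate_index[OF ij(2)]
  moreover have "i - 1 \<noteq> j - 1" if "\<not> i < 2" "\<not> j < 2" using that ij by auto
  ultimately show ?thesis
    using ij single[of "i - 1"] single[of "j - 1"] pair[of "i - 1" "j - 1"]
    by (cases "i < 2"; cases "j < 2") (simp_all add: var_bideg_def del: One_nat_def)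
qed

text \<open>
  By the previous results \<open>d + deg z\<^sub>i + deg z\<^sub>j = e + deg m\<close> for two different coordinates and a
  monomial \<open>m\<close>. The second degree of \<open>m\<close> is nonnegative, and so is the first one if all \<open>a i \<le> 0\<close>. What
  remains is the largest value of \<open>deg z\<^sub>i + deg z\<^sub>j\<close> over the pairs of coordinates.
\<close>

theorem corollary5p3:
  fixes n :: nat and a :: "nat \<Rightarrow> int"
    and d e :: "int \<times> int"
    and F :: "(nat \<Rightarrow> cpoly) set" and X :: "nat \<Rightarrow> cpoly" and f :: cpoly
  assumes "1 \<le> n"
    and "foliation n a d F"
    and "X \<in> F"
    and "hypersurface_eq n a e f"
    and "strongly_quasi_smooth n f"
    and "invariant_hypersurface n a X f"
  shows "(n = 1 \<longrightarrow> snd e \<le> snd d + 1) \<and>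
         (n > 1 \<longrightarrow> snd e \<le> snd d + 2) \<and>
         ((\<forall>i\<in>{1..n}. a i \<le> 0) \<longrightarrow>
            ((\<forall>i\<in>{1..n}. a i = 0) \<longrightarrow> fst e \<le> fst d + 2) \<and>
            ((\<forall>i\<in>{2..n}. a i = 0) \<and> a 1 < 0 \<longrightarrow> fst e \<le> fst d + 1 - a 1) \<and>
            ((\<exists>i\<in>{1..n}. \<exists>j\<in>{1..n}. i \<noteq> j \<and> a i < 0 \<and> a j < 0) \<longrightarrow>
               fst e \<le> fst d - Min {a i + a j | i j. 1 \<le> i \<and> i < j \<and> j \<le> n}))"
proof -
  have f: "quasi_homogeneous n a e f" "\<nexists>c. f = const_poly c"
    using assms(4) unfolding hypersurface_eq_def by auto
  have e: "e \<noteq> 0" using quasi_homogeneous_bideg_0_const f by blast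
  have "f \<noteq> 0" using f(2) const_poly_0 by metis
  have X: "qh_vector_field n a d X"
    using assms(2,3) unfolding foliation_def field_class_def by blast
  obtain Y i where Y: "\<And>w. w < n + 2 \<Longrightarrow> quasi_homogeneous n a (d + var_bideg a w) (Y w)"
      "apply_field n Y f = 0" and i: "i < n + 2" "Y i \<noteq> 0"
    using annihilating_field_of_invariant_hypersurface[OF X foliation_not_radial[OF assms(1-3)]
        f(1) e \<open>f \<noteq> 0\<close> assms(6)] by blast
  obtain j m where j: "j < n + 2" "j \<noteq> i" and m: "Poly_Mapping.keys m \<subseteq> {..<n + 2}"
    and deg: "d + var_bideg a i + var_bideg a j = e + monom_bideg a m"
    using bidegree_of_annihilating_field[OF f(1) e assms(5) Y i] by blast
  have snd_le: "snd e \<le> snd d + (snd (var_bideg a i) + snd (var_bideg a j))"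
    using arg_cong[OF deg, of snd] snd_monom_bideg_nonneg[of a m] by simp
  have snd_2: "snd (var_bideg a i) + snd (var_bideg a j) \<le> 2"
    by (simp add: var_bideg_def)
  have snd_1: "snd (var_bideg a i) + snd (var_bideg a j) \<le> 1" if "n = 1"
    using that i j by (auto simp: var_bideg_def)
  have fst_le: "fst e \<le> fst d + (fst (var_bideg a i) + fst (var_bideg a j))"
    if "\<forall>i\<in>{1..n}. a i \<le> 0"
    using arg_cong[OF deg, of fst] fst_monom_bideg_nonneg[OF m that] by simp
  have fst_none: "fst (var_bideg a i) + fst (var_bideg a j) \<le> 2" if "\<forall>i\<in>{1..n}. a i = 0"
    using that fibre_coordinate_index[OF i(1)] fibre_coordinate_index[OF j(1)]
    by (auto simp: var_bideg_def simp del: One_nat_def)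
  have fst_one: "fst (var_bideg a i) + fst (var_bideg a j) \<le> 1 - a 1"
    if zero: "\<forall>i\<in>{2..n}. a i = 0" and neg: "a 1 < 0"
  proof -
    have "fst (var_bideg a w) \<le> (if w = 2 then - a 1 else 1)" if "w < n + 2" for w
    proof -
      \<comment> \<open>The coordinate of index 2 is the one attached to \<open>a 1\<close>.\<close>
      have "w - 1 \<in> {2..n}" if "2 < w" using that \<open>w < n + 2\<close> by auto
      then show ?thesis using zero by (cases w "2::nat" rule: linorder_cases) (auto simp: var_bideg_def)
    qed
    from this[OF i(1)] this[OF j(1)] show ?thesis using j(2) neg by (auto split: if_splits)
  qed
  have fst_two: "fst (var_bideg a i) + fst (var_bideg a j)
      \<le> - Min {a i + a j | i j. 1 \<le> i \<and> i < j \<and> j \<le> n}"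
    if nonpos: "\<forall>i\<in>{1..n}. a i \<le> 0" and two: "\<exists>i\<in>{1..n}. \<exists>j\<in>{1..n}. i \<noteq> j \<and> a i < 0 \<and> a j < 0"
  proof -
    obtain p q where pq: "p \<in> {1..n}" "q \<in> {1..n}" "p \<noteq> q" "a p < 0" "a q < 0"
      using two by blast
    show ?thesis by (rule fst_var_bideg_pair_le[OF i(1) j(1) j(2)[symmetric] nonpos pq])
  qed
  show ?thesis
  proof (intro conjI impI)
    show "snd e \<le> snd d + 1" if "n = 1" using snd_le snd_1[OF that] by linarith
    show "snd e \<le> snd d + 2" using snd_le snd_2 by linarith
    assume nonpos: "\<forall>i\<in>{1..n}. a i \<le> 0"
    show "fst e \<le> fst d + 2" if "\<forall>i\<in>{1..n}. a i = 0"
      using fst_le[OF nonpos] fst_none[OF that] by linarith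
    show "fst e \<le> fst d + 1 - a 1" if "(\<forall>i\<in>{2..n}. a i = 0) \<and> a 1 < 0"
      using fst_le[OF nonpos] fst_one that by linarith
    show "fst e \<le> fst d - Min {a i + a j | i j. 1 \<le> i \<and> i < j \<and> j \<le> n}"
      if "\<exists>i\<in>{1..n}. \<exists>j\<in>{1..n}. i \<noteq> j \<and> a i < 0 \<and> a j < 0"
      using fst_le[OF nonpos] fst_two[OF nonpos that] by linarith
  qed
qed

end
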